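(* Let $n\geq 1$, $\nu\geq 1$, $k\geq 3$. Let $w\in F_n$ be a cyclically reduced word that is non-positive, non-negative, and non-alternating (that is, not a positive word, not a negative word, and not an alternating word) and is not a proper power. Define multisets of integers in $\{0,\ldots,n-1\}$, with one entry for each occurrence of a length-two cyclic subword of $w$ of the indicated form (subscripts mod $n$): $\mathcal{A}$ consists of the $a$ for subwords $x_ix_{i+a}^{-1}$; $\mathcal{B}$ of the $b$ for subwords $x_i^{-1}x_{i+b}$; $\mathcal{Q}^+$ of the $q$ for subwords $x_ix_{i+q}$; $\mathcal{Q}^-$ of the $q$ for subwords $x_{i+q}^{-1}x_i^{-1}$; and $\mathcal{Q}$ is the multiset union of $\mathcal{Q}^+$ and $\mathcal{Q}^-$. Suppose that the cyclic presentation $P_n(w)$ is irreducible and non-redundant. Then $P_n(w)$ is $(2,k,\nu)$-special if and only if the following hold: (a) $n=\nu k$, and $k$ is divisible by $4$; (b) $\mathcal{A},\mathcal{B}\subset\{\nu,3\nu,\ldots,(k-1)\nu\}$ (with no repeated entries) such that $|\mathcal{A}|=|\mathcal{B}|=k/4$, and if $a\in\mathcal{A}$ then $n-a\notin\mathcal{A}$, and if $b\in\mathcal{B}$ then $n-b\notin\mathcal{B}$; (c) $\mathcal{Q}^+\cap\mathcal{Q}^-=\emptyset$ and $\mathcal{Q}=\{s+\nu,s+3\nu,\ldots,s+(k-1)\nu\}$ (entries mod $n$, equality of multisets) for some $0\leq s<n$ such that $\gcd(s,\nu)=1$.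
   Context: Cyclic presentations: $F_n$ is the free group with basis $x_0,\ldots,x_{n-1}$ and $\theta:F_n\to F_n$ is the automorphism $\theta(x_i)=x_{i+1}$ (subscripts mod $n$). For a cyclically reduced word $w\in F_n$, $P_n(w)=\langle x_0,\ldots,x_{n-1}\mid w,\theta(w),\ldots,\theta^{n-1}(w)\rangle$. Throughout it is assumed that $x_0$ is a letter of $w$. $P_n(w)$ is irreducible if the greatest common divisor of $n$ and the subscripts of the generators appearing in $w$ is $1$. A word is positive (negative) if all exponents of its generators are positive (negative), and alternating if it has no cyclic subword of the form $(x_ix_j)^{\pm1}$. The word $w$ is a proper power if $w=v^t$ for some $v$ and some $t\geq 2$. Non-redundant: a relator $r\in R$ of $\langle X\mid R\rangle$ is freely redundant if it is freely trivial or there is $s\in R$ such that $r,s$ are distinct elements of the free group on $X$ and $r$ is freely conjugate to $s$ or to $s^{-1}$. A presentation is non-redundant if it contains no freely redundant relator. Star graph: let $\tilde R$ be the set of all cyclic permutations of elements of $R\cup R^{-1}$. The star graph of $\langle X\mid R\rangle$ (all relators cyclically reduced) is the undirected graph, possibly with multiple edges, with vertex set $X\cup X^{-1}$ and an edge joining $x$ and $y$ for each distinct word of the form $xy^{-1}u$ in $\tilde R$, where the edges corresponding to the inverse pair $xy^{-1}u$, $yx^{-1}u^{-1}$ are identified. Special presentations: let $m\geq 2$, $k\geq 3$, $\nu\geq 1$. A finite presentation $\langle X\mid R\rangle$ is $(m,k,\nu)$-special if (a) its star graph has exactly $\nu$ connected components, which are pairwise isomorphic, each a connected bipartite graph of diameter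 $m$ and girth $2m$ in which each vertex has degree at least $3$; (b) each relator has length $k$; (c) if $m=2$ then $k\geq 4$. Girth is the length of a shortest closed path in which consecutive edges are never equal (so a pair of parallel edges gives such a path of length $2$). *)

theory Defs
  imports "HOL-Algebra.Group" "HOL-Library.Multiset" "HOL-Library.Extended_Nat"
begin

section \<open>Words and free groups\<close>

text \<open>The letter \<open>(x, True)\<close> stands for the generator \<open>x\<close> and \<open>(x, False)\<close> for its inverse.\<close>

type_synonym 'a letter = "'a \<times> bool"
type_synonym 'a word = "'a letter list"

definition inv_letter :: "'a letter \<Rightarrow> 'a letter" where
  "inv_letter = apsnd Not"

definition inv_word :: "'a word \<Rightarrow> 'a word" where
  "inv_word w = rev (map inv_letter w)"

definition reduced :: "'a word \<Rightarrow> bool" where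
  "reduced w \<longleftrightarrow> successively (\<lambda>x y. y \<noteq> inv_letter x) w"

definition cyclically_reduced :: "'a word \<Rightarrow> bool" where
  "cyclically_reduced w \<longleftrightarrow> reduced w \<and> (w \<noteq> [] \<longrightarrow> hd w \<noteq> inv_letter (last w))"

fun cancel_cons :: "'a letter \<Rightarrow> 'a word \<Rightarrow> 'a word" where
  "cancel_cons x [] = [x]"
| "cancel_cons x (y # w) = (if y = inv_letter x then w else x # y # w)"

definition reduce :: "'a word \<Rightarrow> 'a word" where
  "reduce w = foldr cancel_cons w []"

text \<open>Every element of the free group is represented by its unique reduced word.\<close>

definition free_group :: "'a set \<Rightarrow> 'a word monoid" where
  "free_group X =
    \<lparr>carrier = {w. set w \<subseteq> X \<times> UNIV \<and> reduced w},
     monoid.mult = (\<lambda>u v. reduce (u @ v)),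
     one = []\<rparr>"

lemma inv_letter_simps [simp]:
  "inv_letter (inv_letter x) = x" "fst (inv_letter x) = fst x"
  "inv_letter x \<noteq> x" "x \<noteq> inv_letter x"
  "inv_letter x = inv_letter y \<longleftrightarrow> x = y"
  by (cases x; cases y; auto simp: inv_letter_def)+

lemma reduced_Nil [simp]: "reduced []"
  and reduced_Cons: "reduced (x # w) \<longleftrightarrow> reduced w \<and> (w \<noteq> [] \<longrightarrow> hd w \<noteq> inv_letter x)"
  by (auto simp: reduced_def successively_Cons)

lemma reduced_cancel_cons: "reduced w \<Longrightarrow> reduced (cancel_cons x w)"
  by (cases w) (auto simp: reduced_Cons)

lemma cancel_cons_inverse: "reduced w \<Longrightarrow> cancel_cons x (cancel_cons (inv_letter x) w) = w"
  by (cases w; cases "tl w") (auto simp: reduced_Cons)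

lemma reduced_foldr: "reduced v \<Longrightarrow> reduced (foldr cancel_cons u v)"
  by (induction u) (auto intro: reduced_cancel_cons)

lemma reduced_reduce: "reduced (reduce w)"
  by (simp add: reduce_def reduced_foldr)

lemma reduce_reduced: "reduced w \<Longrightarrow> reduce w = w"
proof (induction w)
  case (Cons x w)
  then show ?case by (cases w) (auto simp: reduce_def reduced_Cons)
qed (simp add: reduce_def)

lemma foldr_cancel_cons:
  "reduced u \<Longrightarrow> reduced v \<Longrightarrow>
    foldr cancel_cons (cancel_cons x u) v = cancel_cons x (foldr cancel_cons u v)"
proof (cases u)
  case (Cons y u')
  assume "reduced u" "reduced v"
  then have "cancel_cons x (cancel_cons (inv_letter x) (foldr cancel_cons u' v)) = foldr cancel_cons u' v"
    by (intro cancel_cons_inverse reduced_foldr)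
  then show ?thesis by (simp add: Cons)
qed simp

lemma foldr_reduce: "reduced v \<Longrightarrow> foldr cancel_cons (reduce u) v = foldr cancel_cons u v"
proof (induction u)
  case (Cons x u)
  have "foldr cancel_cons (reduce (x # u)) v = foldr cancel_cons (cancel_cons x (reduce u)) v"
    by (simp add: reduce_def)
  with Cons show ?case by (simp add: foldr_cancel_cons reduced_reduce)
qed (simp add: reduce_def)

lemma reduce_append: "reduce (u @ v) = foldr cancel_cons u (reduce v)"
  by (simp add: reduce_def)

lemma reduce_append_reduce [simp]:
  "reduce (reduce u @ v) = reduce (u @ v)" "reduce (u @ reduce v) = reduce (u @ v)"
  by (simp_all add: reduce_append foldr_reduce reduced_reduce reduce_reduced)

lemma set_cancel_cons: "set (cancel_cons x w) \<subseteq> insert x (set w)"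
  by (cases w) auto

lemma set_reduce: "set (reduce w) \<subseteq> set w"
proof (induction w)
  case (Cons x w)
  then show ?case using set_cancel_cons[of x "reduce w"] by (auto simp: reduce_def)
qed (simp add: reduce_def)

lemma reduce_inv_word_append: "reduce (inv_word w @ w) = []"
proof -
  have "reduced v \<Longrightarrow> foldr cancel_cons (inv_word w) (foldr cancel_cons w v) = v" for v
  proof (induction w arbitrary: v)
    case (Cons x w)
    have "cancel_cons (inv_letter x) (cancel_cons x (foldr cancel_cons w v)) = foldr cancel_cons w v"
      using cancel_cons_inverse[of "foldr cancel_cons w v" "inv_letter x"] Cons.prems
      by (simp add: reduced_foldr)
    with Cons show ?case by (simp add: inv_word_def)
  qed (simp add: inv_word_def)
  from this[of "[]"] show ?thesis by (simp add: reduce_append) (simp add: reduce_def)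
qed

lemma reduced_inv_word: "reduced w \<Longrightarrow> reduced (inv_word w)"
  unfolding reduced_def inv_word_def successively_rev successively_map
  by (erule successively_mono) (metis inv_letter_simps(1))

lemma set_inv_word: "set w \<subseteq> X \<times> UNIV \<Longrightarrow> set (inv_word w) \<subseteq> X \<times> UNIV"
  by (auto simp: inv_word_def inv_letter_def)

lemma group_free_group: "group (free_group X)"
proof (rule groupI)
  fix u v w
  assume "u \<in> carrier (free_group X)" "v \<in> carrier (free_group X)"
  then show "u \<otimes>\<^bsub>free_group X\<^esub> v \<in> carrier (free_group X)"
    using set_reduce[of "u @ v"] by (auto simp: free_group_def reduced_reduce)
  show "u \<otimes>\<^bsub>free_group X\<^esub> v \<otimes>\<^bsub>free_group X\<^esub> w = u \<otimes>\<^bsub>free_group X\<^esub> (v \<otimes>\<^bsub>free_group X\<^esub> w)"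
    by (simp add: free_group_def)
next
  fix w
  assume w: "w \<in> carrier (free_group X)"
  then show "\<one>\<^bsub>free_group X\<^esub> \<otimes>\<^bsub>free_group X\<^esub> w = w"
    by (simp add: free_group_def reduce_reduced)
  show "\<exists>v\<in>carrier (free_group X). v \<otimes>\<^bsub>free_group X\<^esub> w = \<one>\<^bsub>free_group X\<^esub>"
    using w by (intro bexI[of _ "inv_word w"])
      (auto simp: free_group_def reduce_inv_word_append reduced_inv_word dest: set_inv_word)
qed (simp add: free_group_def)

lemma inv_free_group:
  assumes "w \<in> carrier (free_group X)"
  shows "inv\<^bsub>free_group X\<^esub> w = inv_word w"
proof (rule group.inv_equality[OF group_free_group _ assms])
  show "inv_word w \<otimes>\<^bsub>free_group X\<^esub> w = \<one>\<^bsub>free_group X\<^esub>"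
    by (simp add: free_group_def reduce_inv_word_append)
  show "inv_word w \<in> carrier (free_group X)"
    using assms set_inv_word[of w X] by (simp add: free_group_def reduced_inv_word)
qed

definition conjugate_in :: "('g, 'm) monoid_scheme \<Rightarrow> 'g \<Rightarrow> 'g \<Rightarrow> bool" where
  "conjugate_in G a b \<longleftrightarrow> (\<exists>g\<in>carrier G. a = g \<otimes>\<^bsub>G\<^esub> b \<otimes>\<^bsub>G\<^esub> inv\<^bsub>G\<^esub> g)"

definition proper_power :: "('g, 'm) monoid_scheme \<Rightarrow> 'g \<Rightarrow> bool" where
  "proper_power G a \<longleftrightarrow> (\<exists>v\<in>carrier G. \<exists>t::nat. 2 \<le> t \<and> a = v [^]\<^bsub>G\<^esub> t)"


section \<open>Multigraphs\<close>

text \<open>Undirected; \<open>ends e\<close> is the set of endpoints of \<open>e\<close>, a singleton if \<open>e\<close> is a loop.\<close>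

record ('v, 'e) multigraph =
  verts :: "'v set"
  edges :: "'e set"
  ends :: "'e \<Rightarrow> 'v set"

fun walk :: "('v, 'e) multigraph \<Rightarrow> 'v \<Rightarrow> 'e list \<Rightarrow> 'v \<Rightarrow> bool" where
  "walk G u [] v \<longleftrightarrow> u \<in> verts G \<and> u = v"
| "walk G u (e # es) v \<longleftrightarrow>
    u \<in> verts G \<and> e \<in> edges G \<and> (\<exists>x. ends G e = {u, x} \<and> walk G x es v)"

definition reachable :: "('v, 'e) multigraph \<Rightarrow> 'v \<Rightarrow> 'v \<Rightarrow> bool" where
  "reachable G u v \<longleftrightarrow> (\<exists>es. walk G u es v)"

definition connected_graph :: "('v, 'e) multigraph \<Rightarrow> bool" where
  "connected_graph G \<longleftrightarrow> verts G \<noteq> {} \<and> (\<forall>u\<in>verts G. \<forall>v\<in>verts G. reachable G u v)"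

definition induced_subgraph :: "('v, 'e) multigraph \<Rightarrow> 'v set \<Rightarrow> ('v, 'e) multigraph" where
  "induced_subgraph G S =
    \<lparr>verts = S, edges = {e \<in> edges G. ends G e \<subseteq> S}, ends = ends G\<rparr>"

definition graph_components :: "('v, 'e) multigraph \<Rightarrow> ('v, 'e) multigraph set" where
  "graph_components G = (\<lambda>u. induced_subgraph G {v. reachable G u v}) ` verts G"

definition graph_isomorphic :: "('v, 'e) multigraph \<Rightarrow> ('w, 'f) multigraph \<Rightarrow> bool" where
  "graph_isomorphic G H \<longleftrightarrow>
    (\<exists>f g. bij_betw f (verts G) (verts H) \<and> bij_betw g (edges G) (edges H) \<and>
      (\<forall>e\<in>edges G. ends H (g e) = f ` ends G e))"

definition bipartite :: "('v, 'e) multigraph \<Rightarrow> bool" where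
  "bipartite G \<longleftrightarrow>
    (\<exists>A B. A \<union> B = verts G \<and> A \<inter> B = {} \<and>
      (\<forall>e\<in>edges G. \<exists>a\<in>A. \<exists>b\<in>B. ends G e = {a, b}))"

text \<open>A loop contributes two to the degree.\<close>

definition degree :: "('v, 'e) multigraph \<Rightarrow> 'v \<Rightarrow> nat" where
  "degree G v = card {e \<in> edges G. v \<in> ends G e} + card {e \<in> edges G. ends G e = {v}}"

definition distance :: "('v, 'e) multigraph \<Rightarrow> 'v \<Rightarrow> 'v \<Rightarrow> enat" where
  "distance G u v = Inf {enat (length es) | es. walk G u es v}"

definition diameter :: "('v, 'e) multigraph \<Rightarrow> enat" where
  "diameter G = (SUP u\<in>verts G. SUP v\<in>verts G. distance G u v)"

text \<open>Only successive entries of the list of edges are compared, so that a loop counts as a closed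
  path of length 1. Allowing the first and the last edge of a longer closed path to coincide does not
  affect the infimum, since removing both then leaves a shorter closed path.\<close>

definition girth :: "('v, 'e) multigraph \<Rightarrow> enat" where
  "girth G = Inf {enat (length es) | u es. es \<noteq> [] \<and> walk G u es u \<and> distinct_adj es}"


section \<open>Presentations, star graphs and special presentations\<close>

record 'a presentation =
  gens :: "'a set"
  rels :: "'a word set"

definition freely_redundant :: "'a presentation \<Rightarrow> 'a word \<Rightarrow> bool" where
  "freely_redundant P r \<longleftrightarrow>
    (let F = free_group (gens P) in
      r = \<one>\<^bsub>F\<^esub> \<or>
      (\<exists>s\<in>rels P. r \<noteq> s \<and> (conjugate_in F r s \<or> conjugate_in F r (inv\<^bsub>F\<^esub> s))))"

definition non_redundant :: "'a presentation \<Rightarrow> bool" where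
  "non_redundant P \<longleftrightarrow> (\<forall>r\<in>rels P. \<not> freely_redundant P r)"

definition symmetrized_rels :: "'a presentation \<Rightarrow> 'a word set" where
  "symmetrized_rels P = {rotate j r | j r. r \<in> rels P \<union> inv_word ` rels P}"

text \<open>Sends \<open>x y\<inverse> u\<close> to \<open>y x\<inverse> u\<inverse>\<close>.\<close>

fun edge_partner :: "'a word \<Rightarrow> 'a word" where
  "edge_partner (x # y' # u) = inv_letter y' # inv_letter x # inv_word u"
| "edge_partner w = w"

text \<open>An edge is an inverse pair \<open>{x y\<inverse> u, y x\<inverse> u\<inverse>}\<close> of words; its endpoints \<open>x\<close> and \<open>y\<close> are
  the first letters of the two words.\<close>

definition star_graph :: "'a presentation \<Rightarrow> ('a letter, 'a word set) multigraph" where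
  "star_graph P =
    \<lparr>verts = gens P \<times> UNIV,
     edges = {{v, edge_partner v} | v. v \<in> symmetrized_rels P \<and> 2 \<le> length v},
     ends = (\<lambda>e. hd ` e)\<rparr>"

definition special :: "nat \<Rightarrow> nat \<Rightarrow> nat \<Rightarrow> 'a presentation \<Rightarrow> bool" where
  "special m k \<nu> P \<longleftrightarrow>
    2 \<le> m \<and> 3 \<le> k \<and> 1 \<le> \<nu> \<and>
    finite (gens P) \<and> finite (rels P) \<and>
    rels P \<subseteq> carrier (free_group (gens P)) \<and> (\<forall>r\<in>rels P. cyclically_reduced r) \<and>
    card (graph_components (star_graph P)) = \<nu> \<and>
    (\<forall>C\<in>graph_components (star_graph P). \<forall>D\<in>graph_components (star_graph P).
      graph_isomorphic C D) \<and>
    (\<forall>C\<in>graph_components (star_graph P).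
      connected_graph C \<and> bipartite C \<and> diameter C = enat m \<and> girth C = enat (2 * m) \<and>
      (\<forall>v\<in>verts C. 3 \<le> degree C v)) \<and>
    (\<forall>r\<in>rels P. length r = k) \<and>
    (m = 2 \<longrightarrow> 4 \<le> k)"


section \<open>Cyclic presentations\<close>

definition theta :: "nat \<Rightarrow> nat word \<Rightarrow> nat word" where
  "theta n = map (apfst (\<lambda>i. (i + 1) mod n))"

definition cyclic_presentation :: "nat \<Rightarrow> nat word \<Rightarrow> nat presentation" where
  "cyclic_presentation n w = \<lparr>gens = {..<n}, rels = {(theta n ^^ j) w | j. j < n}\<rparr>"

text \<open>Letterwise shifting preserves reducedness, so it is the automorphism of the free group
  determined by \<open>x\<^sub>i \<mapsto> x\<^sub>i\<^sub>+\<^sub>1\<close>.\<close>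

lemma theta_iso: "theta n \<in> iso (free_group {..<n}) (free_group {..<n})"
proof -
  define f where "f = (\<lambda>i. (i + 1) mod n)"
  define \<sigma> :: "nat letter \<Rightarrow> nat letter" where "\<sigma> = apfst f"
  have theta: "theta n = map \<sigma>"
    by (simp add: theta_def \<sigma>_def f_def)
  let ?F = "free_group {..<n}"
  let ?L = "{..<n} \<times> (UNIV :: bool set)"
  have inj_s: "inj_on f {..<n}"
  proof (rule inj_onI)
    have mod_eq: "f i = (if i + 1 = n then 0 else i + 1)" if "i < n" for i
      using that by (cases "i + 1 = n") (auto simp: f_def)
    fix i j
    assume "i \<in> {..<n}" "j \<in> {..<n}" "f i = f j"
    then show "i = j" using mod_eq[of i] mod_eq[of j] by (auto split: if_splits)
  qed
  have inj: "inj_on \<sigma> ?L"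
    using inj_s by (auto simp: inj_on_def \<sigma>_def)
  have map_L: "\<sigma> x \<in> ?L" if "x \<in> ?L" for x
    using that by (cases x) (auto simp: \<sigma>_def f_def)
  have bij: "\<sigma> ` ?L = ?L"
    by (rule card_subset_eq) (use map_L inj in \<open>auto simp: card_image image_subset_iff\<close>)
  have flip: "\<sigma> (inv_letter x) = inv_letter (\<sigma> x)" for x
    by (cases x) (simp add: inv_letter_def \<sigma>_def)
  have inv_L: "inv_letter x \<in> ?L \<longleftrightarrow> x \<in> ?L" for x :: "nat letter"
    by (cases x) (auto simp: inv_letter_def)
  have eq: "\<sigma> y = inv_letter (\<sigma> x) \<longleftrightarrow> y = inv_letter x" if "x \<in> ?L" "y \<in> ?L" for x y
    using inj_onD[OF inj, of y "inv_letter x"] that flip[of x] inv_L[of x] by metis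
  have red: "reduced (theta n w) \<longleftrightarrow> reduced w" if "set w \<subseteq> ?L" for w
    using that
  proof (induction w)
    case (Cons x w)
    show ?case
    proof (cases w)
      case (Cons y v)
      with Cons.IH Cons.prems eq[of x y] show ?thesis by (simp add: theta reduced_Cons)
    qed (simp add: theta reduced_Cons)
  qed (simp add: theta)
  have canc: "theta n (cancel_cons x w) = cancel_cons (\<sigma> x) (theta n w)"
    if "x \<in> ?L" "set w \<subseteq> ?L" for x w
    using that eq[of x] by (cases w) (auto simp: theta)
  have redu: "theta n (reduce w) = reduce (theta n w)" if "set w \<subseteq> ?L" for w
    using that
  proof (induction w)
    case (Cons x w)
    then have "theta n (cancel_cons x (reduce w)) = cancel_cons (\<sigma> x) (theta n (reduce w))"
      by (intro canc) (use set_reduce[of w] in auto)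
    with Cons show ?case by (simp add: reduce_def theta)
  qed (simp add: theta reduce_def)
  have car: "theta n w \<in> carrier ?F" if "w \<in> carrier ?F" for w
  proof -
    from that have w: "set w \<subseteq> ?L" "reduced w" by (auto simp: free_group_def)
    then have "\<sigma> ` set w \<subseteq> ?L" using map_L by blast
    with w red[of w] show ?thesis by (simp add: free_group_def) (simp add: theta)
  qed
  have "theta n \<in> hom ?F ?F"
  proof (rule homI)
    fix u v
    assume "u \<in> carrier ?F" "v \<in> carrier ?F"
    then have "set (u @ v) \<subseteq> ?L" by (auto simp: free_group_def)
    from redu[OF this] show "theta n (u \<otimes>\<^bsub>?F\<^esub> v) = theta n u \<otimes>\<^bsub>?F\<^esub> theta n v"
      by (simp add: free_group_def) (simp add: theta)
  qed (rule car)
  moreover have "inj_on (theta n) (carrier ?F)"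
  proof (rule inj_onI)
    fix u v
    assume "u \<in> carrier ?F" "v \<in> carrier ?F" "theta n u = theta n v"
    then have "map \<sigma> u = map \<sigma> v" "set u \<union> set v \<subseteq> ?L"
      by (auto simp: free_group_def theta)
    then show "u = v"
      using inj_on_subset[OF inj] by (blast intro: map_inj_on)
  qed
  moreover have "carrier ?F \<subseteq> theta n ` carrier ?F"
  proof
    fix w assume w: "w \<in> carrier ?F"
    then have "w \<in> lists (\<sigma> ` ?L)" unfolding bij by (auto simp: free_group_def)
    then obtain v where v: "set v \<subseteq> ?L" "w = theta n v"
      unfolding lists_image theta by auto
    with w red[of v] show "w \<in> theta n ` carrier ?F" by (auto simp: free_group_def)
  qed
  ultimately show ?thesis
    using car by (auto simp: iso_def bij_betw_def)
qed

definition irreducible_cyclic :: "nat \<Rightarrow> nat word \<Rightarrow> bool" where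
  "irreducible_cyclic n w \<longleftrightarrow> Gcd (insert n (fst ` set w)) = 1"

definition positive_word :: "'a word \<Rightarrow> bool" where
  "positive_word w \<longleftrightarrow> (\<forall>x\<in>set w. snd x)"

definition negative_word :: "'a word \<Rightarrow> bool" where
  "negative_word w \<longleftrightarrow> (\<forall>x\<in>set w. \<not> snd x)"

text \<open>The cyclic subwords of length two, one for each starting position.\<close>

definition cyclic_pairs :: "'a word \<Rightarrow> ('a letter \<times> 'a letter) multiset" where
  "cyclic_pairs w = mset (zip w (rotate1 w))"

definition alternating_word :: "'a word \<Rightarrow> bool" where
  "alternating_word w \<longleftrightarrow> (\<forall>(x, y)\<in>#cyclic_pairs w. snd x \<noteq> snd y)"

text \<open>The \<open>d < n\<close> with \<open>j \<equiv> i + d\<close> modulo \<open>n\<close>, for \<open>i, j < n\<close>.\<close>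

definition subscript_diff :: "nat \<Rightarrow> nat \<Rightarrow> nat \<Rightarrow> nat" where
  "subscript_diff n i j = (j + (n - i)) mod n"

definition A_mset :: "nat \<Rightarrow> nat word \<Rightarrow> nat multiset" where
  "A_mset n w = {# subscript_diff n (fst x) (fst y). (x, y) \<in># filter_mset (\<lambda>(x, y). snd x \<and> \<not> snd y) (cyclic_pairs w) #}"

definition B_mset :: "nat \<Rightarrow> nat word \<Rightarrow> nat multiset" where
  "B_mset n w = {# subscript_diff n (fst x) (fst y). (x, y) \<in># filter_mset (\<lambda>(x, y). \<not> snd x \<and> snd y) (cyclic_pairs w) #}"

definition Qplus_mset :: "nat \<Rightarrow> nat word \<Rightarrow> nat multiset" where
  "Qplus_mset n w = {# subscript_diff n (fst x) (fst y). (x, y) \<in># filter_mset (\<lambda>(x, y). snd x \<and> snd y) (cyclic_pairs w) #}"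

text \<open>In \<open>x\<^sub>i\<^sub>+\<^sub>q\<inverse> x\<^sub>i\<inverse>\<close> it is the first subscript that is shifted by \<open>q\<close>.\<close>

definition Qminus_mset :: "nat \<Rightarrow> nat word \<Rightarrow> nat multiset" where
  "Qminus_mset n w = {# subscript_diff n (fst y) (fst x). (x, y) \<in># filter_mset (\<lambda>(x, y). \<not> snd x \<and> \<not> snd y) (cyclic_pairs w) #}"

definition Q_mset :: "nat \<Rightarrow> nat word \<Rightarrow> nat multiset" where
  "Q_mset n w = Qplus_mset n w + Qminus_mset n w"

end

theory Submission
  imports Defs
begin

text \<open>
  The vertices of the star graph of the presentation are \<open>x\<^sub>i\<close> and \<open>x\<^sub>i\<inverse>\<close> for \<open>i\<close> modulo \<open>n\<close>, and adjacency
  is invariant under shifting subscripts. Non-redundancy, together with \<open>w\<close> not being a proper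
  power, makes the edges correspond bijectively to the pairs of a shift and a position in \<open>w\<close>.

  A bipartite graph of diameter 2 is complete bipartite, so being special amounts to having no loops
  and no parallel edges, and to vertices at the ends of a path of length 3 being adjacent. In terms
  of the differences of subscripts of adjacent vertices, the last condition says that the
  differences between positive vertices form the nontrivial coset of \<open>2 d \<int>\<close> in \<open>d \<int>\<close> for some divisor
  \<open>d\<close> of \<open>n\<close>; the same coset then occurs between negative vertices, and a translate of it by some \<open>s\<close>
  between positive and negative ones. The star graph is then a union of \<open>d\<close> complete bipartite graphs,
  so \<open>d = \<nu>\<close>. Since a simple graph realises every difference once, counting residues modulo \<open>n\<close> gives
  \<open>|\<A>| = |\<B>| = k/4\<close> and \<open>n = \<nu> k\<close>. Conversely the same count shows that \<open>\<plusminus>\<A>\<close> and \<open>\<plusminus>\<B>\<close> exhaust the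
  odd multiples of \<open>\<nu>\<close>.
\<close>

section \<open>Rotations of cyclically reduced words\<close>

text \<open>A complete bipartite graph closes up paths of three edges but not of two, so the sets of
  differences are closed under sums of three. Such a set, if symmetric, need not be a subgroup, but
  it becomes one after translation by any of its elements. This is where cosets come from; symmetry
  puts twice the translating element into the subgroup, and the absence of loops, that is of the
  difference 0, keeps the element itself out. Hence the factor 2 and the odd multiples.

  The argument needs a difference of each kind. Letters of both signs give changes of sign in both
  directions, and a non-alternating word has neighbouring letters of equal sign.

  The constant 4 comes from directions. An edge between vertices of equal sign can be read both ways
  and realises two differences, whereas an edge between vertices of opposite signs is read from
  positive to negative and realises one. As the three cosets are equally large, the changes of sign
  in either direction fill a quarter of the positions and the remaining positions one half.\<close>

lemma inv_word_append: "inv_word (u @ v) = inv_word v @ inv_word u"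
  by (simp add: inv_word_def)

lemma inv_word_inv_word [simp]: "inv_word (inv_word w) = w"
  by (simp add: inv_word_def rev_map comp_def)

lemma length_inv_word [simp]: "length (inv_word w) = length w"
  by (simp add: inv_word_def)

lemma nth_inv_word: "i < length w \<Longrightarrow> inv_word w ! i = inv_letter (w ! (length w - Suc i))"
  by (simp add: inv_word_def rev_nth)

text \<open>Inversion reverses the order of the letters, so a rotation to the left becomes one to
  the right, written as a left rotation by the complementary amount.\<close>

lemma inv_word_rotate: "inv_word (rotate m w) = rotate (length w - m mod length w) (inv_word w)"
proof (cases "w = []")
  case False
  define t where "t = m mod length w"
  have "t < length w" using False by (simp add: t_def)
  have "rotate m w = rotate t w" by (simp add: t_def rotate_conv_mod[of m])
  also have "\<dots> = drop t w @ take t w" using \<open>t < length w\<close> by (simp add: rotate_drop_take)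
  finally have "inv_word (rotate m w) = inv_word (take t w) @ inv_word (drop t w)"
    by (simp add: inv_word_append)
  also have "\<dots> = rotate (length w - t) (inv_word (drop t w) @ inv_word (take t w))"
    using rotate_append[of "inv_word (drop t w)" "inv_word (take t w)"] by simp
  also have "inv_word (drop t w) @ inv_word (take t w) = inv_word w"
    by (simp flip: inv_word_append)
  finally show ?thesis by (simp add: t_def)
qed (simp add: inv_word_def)

lemma reduced_appendD: "reduced (u @ v) \<Longrightarrow> reduced u \<and> reduced v"
  by (auto simp: reduced_def successively_append_iff)

lemma reduce_inv_word_append_left: "reduce (inv_word t @ t @ d) = reduce d"
  using reduce_append_reduce(1)[of "inv_word t @ t" d] by (simp add: reduce_inv_word_append)

text \<open>With \<open>r = t d\<close> the rotation is \<open>d t\<close>, the conjugate of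
  \<open>r\<close> by \<open>t\<inverse>\<close>. Multiplication in the free group reduces, hence
  the requirement that the rotated word be reduced already.\<close>

lemma conjugate_in_rotate:
  assumes "r \<in> carrier (free_group X)" "reduced (rotate m r)"
  shows "conjugate_in (free_group X) (rotate m r) r"
proof (cases "r = []")
  case False
  define t where "t = take (m mod length r) r"
  define d where "d = drop (m mod length r) r"
  have r: "r = t @ d" and rot: "rotate m r = d @ t"
    by (simp_all add: t_def d_def rotate_drop_take)
  have t: "t \<in> carrier (free_group X)"
    using assms(1) reduced_appendD[of t d] unfolding r by (auto simp: free_group_def)
  then have it: "inv_word t \<in> carrier (free_group X)"
    using set_inv_word[of t X] by (simp add: free_group_def reduced_inv_word)
  have "rotate m r = inv_word t \<otimes>\<^bsub>free_group X\<^esub> r \<otimes>\<^bsub>free_group X\<^esub> inv\<^bsub>free_group X\<^esub> inv_word t"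
    using assms(2) unfolding inv_free_group[OF it] rot
    by (simp add: free_group_def r)
      (metis reduce_append_reduce(1) reduce_inv_word_append_left reduce_reduced)
  with it show ?thesis unfolding conjugate_in_def by blast
next
  case True
  then have "inv\<^bsub>free_group X\<^esub> [] = []" "[] \<in> carrier (free_group X)"
    using assms(1) inv_free_group[of "[]" X] by (simp_all add: inv_word_def)
  with True show ?thesis
    unfolding conjugate_in_def
    by (intro bexI[of _ "[]"]) (simp_all add: free_group_def reduce_def)
qed

lemma free_group_pow: "v [^]\<^bsub>free_group X\<^esub> (t::nat) = reduce (concat (replicate t v))"
proof (induction t)
  case (Suc t)
  have "concat (replicate t v) @ v = v @ concat (replicate t v)" by (induction t) auto
  with Suc show ?case
    by (simp add: nat_pow_def) (simp add: free_group_def)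
qed (simp add: nat_pow_def free_group_def reduce_def)

text \<open>A rotation that fixes \<open>w\<close> makes two complementary factors of
  \<open>w\<close> commute, and commuting words are powers of a common word
  \<open>zs\<close>.\<close>

lemma proper_power_if_rotate_eq:
  assumes "w \<in> carrier (free_group X)" "rotate m w = w" "0 < m" "m < length w"
  shows "proper_power (free_group X) w"
proof -
  have "drop m w @ take m w = take m w @ drop m w"
    using assms by (simp add: rotate_drop_take)
  from comm_append_are_replicate[OF this] obtain a b zs where
    ab: "concat (replicate a zs) = drop m w" "concat (replicate b zs) = take m w" by blast
  have "a \<noteq> 0" "b \<noteq> 0" using ab assms(3,4) by (auto intro!: Nat.gr0I)
  then obtain a' where a': "a = Suc a'" by (cases a) auto
  have w: "w = concat (replicate (b + a) zs)"
    by (simp add: replicate_add ab)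
  \<comment> \<open>Displaying \<open>zs\<close> as a factor of \<open>w\<close> shows that it
    inherits reducedness and so is an element of the free group.\<close>
  have "concat (replicate b zs) @ zs @ concat (replicate a' zs) = w"
    using ab by (simp add: a')
  then have "reduced (concat (replicate b zs) @ zs @ concat (replicate a' zs))"
    using assms(1) by (simp add: free_group_def)
  then have "reduced zs" using reduced_appendD by blast
  moreover have "set zs \<subseteq> set w" using w \<open>a \<noteq> 0\<close> by auto
  ultimately have zs: "zs \<in> carrier (free_group X)"
    using assms(1) by (auto simp: free_group_def)
  have "w = zs [^]\<^bsub>free_group X\<^esub> (b + a)"
    using assms(1) unfolding free_group_pow w[symmetric]
    by (simp add: free_group_def reduce_reduced)
  with zs \<open>a \<noteq> 0\<close> \<open>b \<noteq> 0\<close> show ?thesis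
    unfolding proper_power_def by (intro bexI[of _ zs] exI[of _ "b + a"]) auto
qed

text \<open>Indexing modulo the length treats the step from the last letter to the first like any
  other.\<close>

lemma cyclically_reduced_nth:
  assumes "cyclically_reduced w" "w \<noteq> []"
  shows "w ! (Suc i mod length w) \<noteq> inv_letter (w ! (i mod length w))"
proof (cases "Suc (i mod length w) = length w")
  case True
  then have "Suc i mod length w = 0" by (metis mod_Suc)
  moreover have "i mod length w = length w - 1" using True by simp
  ultimately show ?thesis
    using assms by (simp add: cyclically_reduced_def hd_conv_nth last_conv_nth)
next
  case False
  then have "Suc (i mod length w) < length w"
    using assms(2) by (simp add: Suc_lessI)
  then show ?thesis
    using assms False by (auto simp: cyclically_reduced_def reduced_def successively_conv_nth mod_Suc)
qed

text \<open>A rotation carrying \<open>w\<close> to its inverse would act on positions as a reflection, which fixes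
  a position or swaps two neighbouring ones.\<close>

lemma rotate_neq_inv_word:
  assumes "cyclically_reduced w" "w \<noteq> []"
  shows "rotate m w \<noteq> inv_word w"
proof
  assume eq: "rotate m w = inv_word w"
  let ?k = "length w"
  have k: "?k > 0" using assms(2) by simp
  have nth: "w ! ((m + i) mod ?k) = inv_letter (w ! (?k - Suc i))" if "i < ?k" for i
    using that eq nth_rotate[of i w m] nth_inv_word[of i w] by simp
  \<comment> \<open>\<open>c\<close> is where the last letter of \<open>w\<close> lands after the
    rotation. For \<open>i \<le> c\<close> the letters at \<open>?k - 1 - i\<close> and
    \<open>?k - 1 - (c - i)\<close> are then mutually inverse, and halving \<open>c\<close> makes
    the two positions equal or neighbouring.\<close>
  define c where "c = (?k - 1 + (?k - m mod ?k)) mod ?k"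
  have c: "c < ?k" using k by (simp add: c_def)
  have mc: "(m + c) mod ?k = ?k - 1"
  proof -
    have "(m + c) mod ?k = (m mod ?k + (?k - 1 + (?k - m mod ?k))) mod ?k"
      unfolding c_def by (metis mod_add_left_eq mod_add_right_eq)
    also have "m mod ?k + (?k - 1 + (?k - m mod ?k)) = ?k - 1 + ?k"
      using mod_less_divisor[OF k, of m] by linarith
    also have "(?k - 1 + ?k) mod ?k = (?k - 1) mod ?k" by (rule mod_add_self2)
    also have "\<dots> = ?k - 1" using k by (intro mod_less) simp
    finally show ?thesis .
  qed
  define i where "i = c div 2"
  have i: "i < ?k" "i \<le> c" using c by (auto simp: i_def)
  have "(m + i + (c - i)) mod ?k = ?k - 1" using mc i by (simp add: add.assoc)
  then have mi: "(m + i) mod ?k = ?k - 1 - (c - i)"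
  proof -
    have "((m + i) mod ?k + (c - i)) mod ?k = ?k - 1"
      using \<open>(m + i + (c - i)) mod ?k = ?k - 1\<close> by (simp add: mod_add_left_eq)
    moreover have "(m + i) mod ?k < ?k" using k by simp
    moreover have "c - i < ?k" using c by simp
    ultimately show ?thesis
      by (cases "(m + i) mod ?k + (c - i) < ?k") (simp_all add: le_mod_geq)
  qed
  consider "c - i = i" | "c - i = Suc i" unfolding i_def by linarith
  then show False
  proof cases
    case 1
    then show False using nth[OF i(1)] mi by simp
  next
    case 2
    then have "Suc i < ?k" using c by linarith
    then have "w ! (?k - 1 - Suc i) = inv_letter (w ! (?k - 1 - i))" using nth[OF i(1)] mi 2 by simp
    moreover have "Suc (?k - 1 - Suc i) mod ?k = ?k - 1 - i" "(?k - 1 - Suc i) mod ?k = ?k - 1 - Suc i"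
      using \<open>Suc i < ?k\<close> by (simp_all add: Suc_diff_Suc)
    ultimately show False
      using cyclically_reduced_nth[OF assms, of "?k - 1 - Suc i"] by (metis inv_letter_simps(1))
  qed
qed

text \<open>Inversion moves the two leading letters to the end, and rotating past the rest brings
  them back to the front. So the partner of a rotated relator is a rotation of the inverse
  relator.\<close>

lemma edge_partner_rotate:
  "2 \<le> length v \<Longrightarrow> edge_partner v = rotate (length v - 2) (inv_word v)"
proof (cases v rule: edge_partner.cases)
  case (1 x y u)
  then show ?thesis
    using rotate_append[of "inv_word u" "[inv_letter y, inv_letter x]"] by (simp add: inv_word_def)
qed auto

lemma edge_partner_edge_partner: "2 \<le> length v \<Longrightarrow> edge_partner (edge_partner v) = v"
  by (cases v rule: edge_partner.cases) auto

section \<open>Unions of complete bipartite graphs\<close>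

definition adjacent :: "('v, 'e) multigraph \<Rightarrow> 'v \<Rightarrow> 'v \<Rightarrow> bool" where
  "adjacent G u v \<longleftrightarrow> (\<exists>e\<in>edges G. ends G e = {u, v})"

text \<open>A \<open>multigraph\<close> record does not by itself force the ends of an edge to be
  one or two of its vertices.\<close>

definition wellformed :: "('v, 'e) multigraph \<Rightarrow> bool" where
  "wellformed G \<longleftrightarrow> (\<forall>e\<in>edges G. \<exists>u\<in>verts G. \<exists>v\<in>verts G. ends G e = {u, v})"

abbreviation component :: "('v, 'e) multigraph \<Rightarrow> 'v \<Rightarrow> ('v, 'e) multigraph" where
  "component G u \<equiv> induced_subgraph G {v. reachable G u v}"

section \<open>Walks, reachability and connected components\<close>

lemma adjacent_sym: "adjacent G u v \<Longrightarrow> adjacent G v u"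
  by (auto simp: adjacent_def insert_commute)

lemma adjacent_verts: "wellformed G \<Longrightarrow> adjacent G u v \<Longrightarrow> u \<in> verts G \<and> v \<in> verts G"
  unfolding wellformed_def adjacent_def by (metis doubleton_eq_iff)

lemma walk_verts: "walk G u es v \<Longrightarrow> u \<in> verts G \<and> v \<in> verts G"
  by (induction es arbitrary: u) auto

lemma walk_append: "walk G u es v \<Longrightarrow> walk G v fs x \<Longrightarrow> walk G u (es @ fs) x"
  by (induction es arbitrary: u) auto

text \<open>Stated separately so that \<open>subst\<close> can unfold a concrete walk one edge at a
  time.\<close>

lemma walk_Cons_iff:
  "walk G u (e # es) v \<longleftrightarrow>
    u \<in> verts G \<and> e \<in> edges G \<and> (\<exists>x. ends G e = {u, x} \<and> walk G x es v)"
  by simp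

lemma reachable_refl: "u \<in> verts G \<Longrightarrow> reachable G u u"
  unfolding reachable_def by (rule exI[of _ "[]"]) simp

lemma reachable_trans: "reachable G u v \<Longrightarrow> reachable G v x \<Longrightarrow> reachable G u x"
  unfolding reachable_def using walk_append by metis

lemma reachable_verts: "reachable G u v \<Longrightarrow> u \<in> verts G \<and> v \<in> verts G"
  unfolding reachable_def using walk_verts by metis

lemma adjacent_reachable:
  assumes "wellformed G" "adjacent G u v"
  shows "reachable G u v"
proof -
  from assms(2) obtain e where "e \<in> edges G" "ends G e = {u, v}" by (auto simp: adjacent_def)
  then have "walk G u [e] v" using adjacent_verts[OF assms] by auto
  then show ?thesis unfolding reachable_def by blast
qed

lemma walk_induct [consumes 2, case_names Nil Cons]:
  assumes "walk G u es v" "wellformed G"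
    and "P v []"
    and "\<And>u x e es. adjacent G u x \<Longrightarrow> walk G x es v \<Longrightarrow> P x es \<Longrightarrow> P u (e # es)"
  shows "P u es"
  using assms(1)
proof (induction es arbitrary: u)
  case (Cons e es)
  then obtain x where "e \<in> edges G" "ends G e = {u, x}" "walk G x es v" by auto
  with Cons.IH[of x] assms(4)[of u x es e] show ?case by (auto simp: adjacent_def)
qed (use assms in auto)

lemma reachable_sym:
  assumes "wellformed G" "reachable G u v"
  shows "reachable G v u"
proof -
  from assms(2) obtain es where w: "walk G u es v" by (auto simp: reachable_def)
  then have "v \<in> verts G" using walk_verts by metis
  from w assms(1) show ?thesis
  proof (induction rule: walk_induct)
    case Nil
    then show ?case using \<open>v \<in> verts G\<close> by (rule reachable_refl)
  next
    case (Cons u x e es)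
    then show ?case
      using adjacent_reachable[OF assms(1) adjacent_sym] reachable_trans by metis
  qed
qed

lemma verts_component [simp]: "verts (component G u) = {v. reachable G u v}"
  and ends_component [simp]: "ends (component G u) = ends G"
  by (simp_all add: induced_subgraph_def)

lemma edge_in_component:
  assumes "wellformed G" "e \<in> edges G" "ends G e = {x, y}" "reachable G u x"
  shows "e \<in> edges (component G u)" "reachable G u y"
proof -
  have "adjacent G x y" using assms by (auto simp: adjacent_def)
  then show "reachable G u y"
    using assms adjacent_reachable reachable_trans by metis
  then show "e \<in> edges (component G u)"
    using assms by (simp add: induced_subgraph_def)
qed

lemma walk_component:
  assumes "wellformed G" "reachable G u x" "walk G x es y"
  shows "walk (component G u) x es y"
  using assms(2,3)
proof (induction es arbitrary: x)
  case (Cons e es)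
  then obtain z where z: "e \<in> edges G" "ends G e = {x, z}" "walk G z es y" by auto
  with edge_in_component[OF assms(1) z(1,2) Cons.prems(1)] Cons show ?case by auto
qed auto

lemma walk_componentD: "walk (component G u) x es y \<Longrightarrow> walk G x es y"
proof (induction es arbitrary: x)
  case Nil
  then show ?case by (auto dest: reachable_verts)
next
  case (Cons e es)
  then show ?case by (auto simp: induced_subgraph_def dest: reachable_verts)
qed

lemma connected_component:
  assumes "wellformed G" "u \<in> verts G"
  shows "connected_graph (component G u)"
  unfolding connected_graph_def verts_component
proof (intro conjI ballI)
  show "{v. reachable G u v} \<noteq> {}" using reachable_refl[OF assms(2)] by blast
  fix x y assume "x \<in> {v. reachable G u v}" "y \<in> {v. reachable G u v}"
  then have "reachable G u x" "reachable G x y"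
    using reachable_sym[OF assms(1)] reachable_trans by (metis mem_Collect_eq)+
  then show "reachable (component G u) x y"
    using walk_component[OF assms(1)] unfolding reachable_def by metis
qed

lemma component_eq_iff_reachable:
  assumes "wellformed G" "u \<in> verts G" "v \<in> verts G"
  shows "component G u = component G v \<longleftrightarrow> reachable G u v"
proof
  assume "component G u = component G v"
  then have "verts (component G u) = verts (component G v)" by simp
  then show "reachable G u v" using reachable_refl[OF assms(3)] by auto
next
  assume "reachable G u v"
  then have "reachable G u x \<longleftrightarrow> reachable G v x" for x
    using reachable_sym[OF assms(1)] reachable_trans by metis
  then show "component G u = component G v" by simp
qed

lemma walk_parity:
  assumes "walk G u es v" "A \<union> B = verts G" "A \<inter> B = {}"
    and "\<And>e. e \<in> edges G \<Longrightarrow> \<exists>a\<in>A. \<exists>b\<in>B. ends G e = {a, b}"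
  shows "u \<in> A \<longleftrightarrow> (v \<in> A \<longleftrightarrow> even (length es))"
  using assms(1)
proof (induction es arbitrary: u)
  case (Cons e es)
  then obtain x where x: "e \<in> edges G" "ends G e = {u, x}" "walk G x es v" by auto
  with assms(4)[OF x(1)] have "u \<in> A \<longleftrightarrow> x \<notin> A"
    using assms(3) by (auto simp: doubleton_eq_iff)
  with Cons.IH[OF x(3)] show ?case by auto
qed auto

section \<open>Distance, girth and bipartite graphs\<close>

lemma distance_le: "walk G u es v \<Longrightarrow> distance G u v \<le> enat (length es)"
  unfolding distance_def by (rule Inf_lower) blast

text \<open>Passing to the strict bound \<open>Suc m\<close> turns the infimum into a witness, and
  being below \<open>Suc m\<close> is again being at most \<open>m\<close>.\<close>

lemma distance_leD:
  assumes "distance G u v \<le> enat m"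
  obtains es where "walk G u es v" "length es \<le> m"
proof -
  have "distance G u v < enat (Suc m)" using assms by (rule le_less_trans) simp
  then obtain es where "walk G u es v" "enat (length es) < enat (Suc m)"
    unfolding distance_def by (auto simp: Inf_less_iff)
  then show ?thesis using that by simp
qed

lemma girth_le: "walk G u es u \<Longrightarrow> es \<noteq> [] \<Longrightarrow> distinct_adj es \<Longrightarrow> girth G \<le> enat (length es)"
  unfolding girth_def by (rule Inf_lower) blast

text \<open>The vertices \<open>u\<close> and \<open>y\<close> lie in different parts, so their distance, which is at most 2, is odd.\<close>

lemma bipartite_diameter_2_adjacent:
  assumes "bipartite G" "diameter G = 2"
    and "adjacent G u v" "adjacent G v x" "adjacent G x y"
    and "u \<in> verts G" "y \<in> verts G"
  shows "adjacent G u y"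
proof -
  from assms(1) obtain A B where "A \<union> B = verts G \<and> A \<inter> B = {} \<and>
    (\<forall>e\<in>edges G. \<exists>a\<in>A. \<exists>b\<in>B. ends G e = {a, b})"
    unfolding bipartite_def by (elim exE)
  then have AB: "A \<union> B = verts G" "A \<inter> B = {}"
    "\<And>e. e \<in> edges G \<Longrightarrow> \<exists>a\<in>A. \<exists>b\<in>B. ends G e = {a, b}"
    by simp_all
  have flip: "a \<in> A \<longleftrightarrow> b \<notin> A" if ab: "adjacent G a b" for a b
  proof -
    from ab obtain e where e: "e \<in> edges G" "ends G e = {a, b}" by (auto simp: adjacent_def)
    with AB(3)[OF e(1)] AB(2) show ?thesis by (auto simp: doubleton_eq_iff)
  qed
  have "distance G u y \<le> diameter G"
    unfolding diameter_def using assms(6,7) by (meson SUP_upper order_trans)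
  then have "distance G u y \<le> enat 2" using assms(2) by (simp add: numeral_eq_enat)
  then obtain es where es: "walk G u es y" "length es \<le> 2" by (rule distance_leD)
  from walk_parity[OF es(1) AB] flip[OF assms(3)] flip[OF assms(4)] flip[OF assms(5)]
  have "odd (length es)" by blast
  with es(2) have "length es = 1" by (cases "length es" rule: nat.exhaust) (auto elim: oddE)
  then obtain e where "es = [e]" by (auto simp: length_Suc_conv)
  with es(1) show ?thesis by (auto simp: adjacent_def)
qed

lemma bipartite_not_adjacent_refl:
  assumes "bipartite G"
  shows "\<not> adjacent G u u"
proof
  assume "adjacent G u u"
  then obtain e where e: "e \<in> edges G" "ends G e = {u, u}" by (auto simp: adjacent_def)
  from assms obtain A B where "A \<union> B = verts G \<and> A \<inter> B = {} \<and>
    (\<forall>e\<in>edges G. \<exists>a\<in>A. \<exists>b\<in>B. ends G e = {a, b})"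
    unfolding bipartite_def by (elim exE)
  with e(1) obtain a b where "a \<in> A" "b \<in> B" "A \<inter> B = {}" "ends G e = {a, b}" by meson
  with e(2) show False by auto
qed

text \<open>Two distinct edges with the same ends, traversed there and back, form a closed path of
  length 2.\<close>

lemma girth_4_inj_on_ends:
  assumes "girth G = 4" "wellformed G"
  shows "inj_on (ends G) (edges G)"
proof (rule inj_onI, rule ccontr)
  fix e f
  assume e: "e \<in> edges G" and f: "f \<in> edges G" "ends G e = ends G f" "e \<noteq> f"
  from e assms(2) obtain u v where uv: "ends G e = {u, v}" "u \<in> verts G" "v \<in> verts G"
    unfolding wellformed_def by blast
  then have "walk G v [f] u" using f by (auto simp: insert_commute)
  then have "walk G u [e, f] u" using uv e by auto
  from girth_le[OF this] f(3) have "girth G \<le> 2" by (simp add: numeral_eq_enat numeral_2_eq_2)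
  then show False using assms(1) by simp
qed

lemma component_in_graph_components: "u \<in> verts G \<Longrightarrow> component G u \<in> graph_components G"
  by (simp add: graph_components_def)

lemma adjacent_component:
  assumes "wellformed G" "adjacent G x y" "reachable G u x"
  shows "adjacent (component G u) x y"
proof -
  from assms(2) obtain e where "e \<in> edges G" "ends G e = {x, y}" by (auto simp: adjacent_def)
  with edge_in_component(1)[OF assms(1) this assms(3)] show ?thesis by (auto simp: adjacent_def)
qed

lemma adjacent_componentD: "adjacent (component G u) x y \<Longrightarrow> adjacent G x y"
  by (auto simp: adjacent_def induced_subgraph_def)

lemma wellformed_component:
  assumes "wellformed G"
  shows "wellformed (component G u)"
  unfolding wellformed_def
proof
  fix e assume "e \<in> edges (component G u)"
  then have e: "e \<in> edges G" "ends G e \<subseteq> verts (component G u)"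
    by (auto simp: induced_subgraph_def)
  with assms obtain x y where "ends G e = {x, y}" unfolding wellformed_def by meson
  with e(2) show "\<exists>x\<in>verts (component G u). \<exists>y\<in>verts (component G u). ends (component G u) e = {x, y}"
    by (intro bexI[of _ x] bexI[of _ y]) simp_all
qed

text \<open>What being special says about single components. The conclusions drawn concern the whole
  graph: no loops, no parallel edges, and the closure of paths of three edges. They transfer because
  a path, or a pair of edges with common ends, lies within one component.\<close>

locale bipartite_components =
  fixes G :: "('v, 'e) multigraph"
  assumes wf: "wellformed G"
    and components: "\<And>C. C \<in> graph_components G \<Longrightarrow> bipartite C \<and> diameter C = 2 \<and> girth C = 4"
begin

lemma not_adjacent_refl: "\<not> adjacent G u u"
proof
  assume u: "adjacent G u u"
  then have "u \<in> verts G" using adjacent_verts[OF wf] by blast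
  then show False
    using adjacent_component[OF wf u reachable_refl] bipartite_not_adjacent_refl components
      component_in_graph_components by metis
qed

lemma adjacent_triple:
  assumes "adjacent G u v" "adjacent G v x" "adjacent G x y"
  shows "adjacent G u y"
proof -
  have u: "u \<in> verts G" using adjacent_verts[OF wf] assms by blast
  have r: "reachable G u u" "reachable G u v" "reachable G u x" "reachable G u y"
    using adjacent_reachable[OF wf] assms reachable_refl[OF u] reachable_trans by metis+
  have "adjacent (component G u) u y"
    by (rule bipartite_diameter_2_adjacent[of _ _ v x])
      (use components[OF component_in_graph_components[OF u]] adjacent_component[OF wf] assms r in auto)
  then show ?thesis by (rule adjacent_componentD)
qed

lemma inj_on_ends: "inj_on (ends G) (edges G)"
proof (rule inj_onI)
  fix e f
  assume e: "e \<in> edges G" and f: "f \<in> edges G" "ends G e = ends G f"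
  from e wf obtain u v where uv: "ends G e = {u, v}" "u \<in> verts G" "v \<in> verts G"
    unfolding wellformed_def by blast
  have r: "reachable G u u" using uv by (simp add: reachable_refl)
  have "inj_on (ends G) (edges (component G u))"
    using girth_4_inj_on_ends[of "component G u"] components[OF component_in_graph_components[OF uv(2)]]
      wellformed_component[OF wf] by simp
  then show "e = f"
    using edge_in_component(1)[OF wf _ _ r] e f uv by (metis inj_onD)
qed

end

text \<open>Such a graph is a union of \<open>d\<close> complete bipartite graphs, one for each residue modulo \<open>d\<close>.\<close>

locale coloured_graph =
  fixes G :: "('v, 'e) multigraph" and \<sigma> :: "'v \<Rightarrow> int" and d :: nat
  assumes wf: "wellformed G"
    and inj_ends: "inj_on (ends G) (edges G)"
    and d_pos: "0 < d"
    and adjacent_iff: "\<And>u v. u \<in> verts G \<Longrightarrow> v \<in> verts G \<Longrightarrow>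
      adjacent G u v \<longleftrightarrow> 2 * int d dvd \<sigma> v - \<sigma> u - int d"
    and classes: "\<And>r. 3 \<le> card {v \<in> verts G. 2 * int d dvd \<sigma> v - r}"
    and shift: "\<And>t. \<exists>f. bij_betw f (verts G) (verts G) \<and>
      (\<forall>v\<in>verts G. 2 * int d dvd \<sigma> (f v) - \<sigma> v - t)"
begin

lemma dvd_double_cases:
  fixes x :: int
  assumes "int d dvd x"
  shows "2 * int d dvd x \<or> 2 * int d dvd x - int d"
proof -
  from assms obtain y where y: "x = int d * y" by blast
  show ?thesis
  proof (cases "even y")
    case False
    then obtain z where "y = 2 * z + 1" by (rule oddE)
    then show ?thesis by (simp add: y algebra_simps)
  qed (auto simp: y)
qed

text \<open>Two vertices of one colour are what the diameter and the girth need: a pair of distinct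
  non-adjacent vertices, and opposite corners of a 4-cycle.\<close>

lemma class_obtains:
  obtains u v where "u \<in> verts G" "2 * int d dvd \<sigma> u - r" "v \<in> verts G" "2 * int d dvd \<sigma> v - r"
    "u \<noteq> v"
proof -
  have "2 \<le> card {v \<in> verts G. 2 * int d dvd \<sigma> v - r}" using classes[of r] by linarith
  then obtain T where "T \<subseteq> {v \<in> verts G. 2 * int d dvd \<sigma> v - r}" "card T = 2"
    by (rule obtain_subset_with_card_n) blast
  then show ?thesis using that by (auto simp: card_2_iff)
qed

lemma adjacent_dvd: "adjacent G u v \<Longrightarrow> 2 * int d dvd \<sigma> v - \<sigma> u - int d"
  using adjacent_iff adjacent_verts[OF wf] by blast

text \<open>Any vertex whose colour is that of \<open>u\<close> plus \<open>d\<close> is a common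
  neighbour.\<close>

lemma same_class_walk:
  assumes "u \<in> verts G" "v \<in> verts G" "2 * int d dvd \<sigma> v - \<sigma> u"
  obtains e f where "walk G u [e, f] v"
proof -
  obtain x where x: "x \<in> verts G" "2 * int d dvd \<sigma> x - (\<sigma> u + int d)"
    using class_obtains by metis
  have "adjacent G u x" using x assms by (simp add: adjacent_iff algebra_simps)
  moreover have "adjacent G x v"
  proof -
    have "\<sigma> v - \<sigma> x - int d = (\<sigma> v - \<sigma> u) - (\<sigma> x - (\<sigma> u + int d)) - 2 * int d" by simp
    then show ?thesis using x assms by (metis adjacent_iff dvd_diff dvd_refl)
  qed
  ultimately obtain e f where "e \<in> edges G" "ends G e = {u, x}" "f \<in> edges G" "ends G f = {x, v}"
    unfolding adjacent_def by blast
  then have "walk G u [e, f] v" using assms x by auto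
  then show ?thesis by (rule that)
qed

lemma short_walk:
  assumes "u \<in> verts G" "v \<in> verts G" "int d dvd \<sigma> v - \<sigma> u"
  obtains es where "walk G u es v" "length es \<le> 2"
  using dvd_double_cases[OF assms(3)]
proof
  assume "2 * int d dvd \<sigma> v - \<sigma> u"
  with assms(1,2) obtain e f where "walk G u [e, f] v" by (rule same_class_walk)
  then show ?thesis using that[of "[e, f]"] by simp
next
  assume "2 * int d dvd \<sigma> v - \<sigma> u - int d"
  then obtain e where "e \<in> edges G" "ends G e = {u, v}"
    using assms adjacent_iff unfolding adjacent_def by blast
  then have "walk G u [e] v" using assms by auto
  then show ?thesis using that[of "[e]"] by simp
qed

lemma reachable_iff:
  assumes "u \<in> verts G" "v \<in> verts G"
  shows "reachable G u v \<longleftrightarrow> int d dvd \<sigma> v - \<sigma> u"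
proof
  assume "reachable G u v"
  then obtain es where "walk G u es v" by (auto simp: reachable_def)
  from this wf show "int d dvd \<sigma> v - \<sigma> u"
  proof (induction rule: walk_induct)
    case (Cons u x e es)
    have "int d dvd \<sigma> x - \<sigma> u - int d"
      using adjacent_dvd[OF Cons.hyps(1)] dvd_mult_right by blast
    then have "int d dvd (\<sigma> v - \<sigma> x) + (\<sigma> x - \<sigma> u - int d) + int d"
      using Cons.IH by (intro dvd_add) auto
    then show ?case by simp
  qed auto
next
  assume "int d dvd \<sigma> v - \<sigma> u"
  from short_walk[OF assms this] show "reachable G u v" unfolding reachable_def by metis
qed

lemma verts_component_eq:
  "u \<in> verts G \<Longrightarrow> verts (component G u) = {v \<in> verts G. int d dvd \<sigma> v - \<sigma> u}"
  using reachable_iff by (auto dest: reachable_verts)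

lemma component_eq_iff:
  assumes "u \<in> verts G" "v \<in> verts G"
  shows "component G u = component G v \<longleftrightarrow> int d dvd \<sigma> v - \<sigma> u"
  using component_eq_iff_reachable[OF wf assms] reachable_iff[OF assms] by simp

lemma card_components: "card (graph_components G) = d"
proof -
  \<comment> \<open>A representative of the residue \<open>r\<close> modulo \<open>d\<close>, chosen
    within the finer class modulo \<open>2 * d\<close>, which is known to be nonempty.\<close>
  define c where "c r = (SOME v. v \<in> verts G \<and> 2 * int d dvd \<sigma> v - int r)" for r :: nat
  have c: "c r \<in> verts G \<and> 2 * int d dvd \<sigma> (c r) - int r" for r
    unfolding c_def by (rule someI_ex) (metis class_obtains)
  have cd: "int d dvd \<sigma> (c r) - int r" for r using c dvd_mult_right by blast
  have "graph_components G = (\<lambda>r. component G (c r)) ` {..<d}"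
  proof (intro equalityI subsetI)
    fix C assume "C \<in> graph_components G"
    then obtain u where u: "u \<in> verts G" "C = component G u" by (auto simp: graph_components_def)
    define r where "r = nat (\<sigma> u mod int d)"
    have "int r = \<sigma> u mod int d" using d_pos by (simp add: r_def)
    then have "int d dvd int r - \<sigma> u" by (simp add: mod_eq_dvd_iff[symmetric])
    with cd[of r] have "int d dvd (\<sigma> (c r) - int r) + (int r - \<sigma> u)" by (rule dvd_add)
    then have "C = component G (c r)" using u c component_eq_iff by simp
    moreover have "r < d" using d_pos by (simp add: r_def nat_less_iff)
    ultimately show "C \<in> (\<lambda>r. component G (c r)) ` {..<d}" by blast
  qed (use c in \<open>auto simp: graph_components_def\<close>)
  moreover have "inj_on (\<lambda>r. component G (c r)) {..<d}"
  proof (rule inj_onI)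
    fix r s assume "r \<in> {..<d}" "s \<in> {..<d}" "component G (c r) = component G (c s)"
    then have "int d dvd \<sigma> (c s) - \<sigma> (c r)" using component_eq_iff c by simp
    from dvd_diff[OF dvd_add[OF this cd[of r]] cd[of s]] have "int d dvd int s - int r" by simp
    then have "int s mod int d = int r mod int d" by (simp add: mod_eq_dvd_iff)
    then show "r = s" using \<open>r \<in> {..<d}\<close> \<open>s \<in> {..<d}\<close> by simp
  qed
  ultimately show ?thesis by (simp add: card_image)
qed

text \<open>Every edge changes the colour by \<open>d\<close> modulo \<open>2 * d\<close>; for a
  closed walk this leaves only even lengths.\<close>

lemma walk_colour:
  assumes "walk G u es v"
  shows "2 * int d dvd \<sigma> v - \<sigma> u - int (length es) * int d"
  using assms wf
proof (induction rule: walk_induct)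
  case (Cons u x e es)
  have "2 * int d dvd (\<sigma> v - \<sigma> x - int (length es) * int d) + (\<sigma> x - \<sigma> u - int d)"
    using adjacent_dvd[OF Cons.hyps(1)] Cons.IH by (rule dvd_add[rotated])
  then show ?case by (simp add: algebra_simps)
qed auto

lemma not_dvd_d: "\<not> 2 * int d dvd int d"
  using d_pos by (auto dest: zdvd_imp_le)

lemma bipartite_component:
  assumes "u \<in> verts G"
  shows "bipartite (component G u)"
proof -
  define A where "A = {v \<in> verts G. 2 * int d dvd \<sigma> v - \<sigma> u}"
  define B where "B = {v \<in> verts G. 2 * int d dvd \<sigma> v - \<sigma> u - int d}"
  have "A \<union> B = verts (component G u)"
  proof -
    have "int d dvd \<sigma> v - \<sigma> u \<longleftrightarrow> 2 * int d dvd \<sigma> v - \<sigma> u \<or> 2 * int d dvd \<sigma> v - \<sigma> u - int d" for v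
    proof
      assume "2 * int d dvd \<sigma> v - \<sigma> u \<or> 2 * int d dvd \<sigma> v - \<sigma> u - int d"
      then have "int d dvd \<sigma> v - \<sigma> u \<or> int d dvd \<sigma> v - \<sigma> u - int d" using dvd_mult_right by blast
      then show "int d dvd \<sigma> v - \<sigma> u" by (metis diff_add_cancel dvd_add dvd_refl)
    qed (rule dvd_double_cases)
    then show ?thesis unfolding verts_component_eq[OF assms] by (auto simp: A_def B_def)
  qed
  moreover have "A \<inter> B = {}"
  proof -
    have False if "2 * int d dvd x" "2 * int d dvd x - int d" for x
      using dvd_diff[OF that] not_dvd_d by simp
    then show ?thesis by (auto simp: A_def B_def)
  qed
  moreover have "\<exists>a\<in>A. \<exists>b\<in>B. ends G e = {a, b}" if e: "e \<in> edges (component G u)" for e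
  proof -
    have e': "e \<in> edges G" "ends G e \<subseteq> verts (component G u)"
      using e by (auto simp: induced_subgraph_def)
    then obtain x y where xy: "ends G e = {x, y}" using wf unfolding wellformed_def by blast
    then have ad: "adjacent G x y" using e' by (auto simp: adjacent_def)
    have x: "x \<in> A \<union> B" "y \<in> A \<union> B" using e' xy \<open>A \<union> B = verts (component G u)\<close> by auto
    have nd: "2 * int d dvd \<sigma> y - \<sigma> x - int d" using adjacent_dvd[OF ad] .
    show ?thesis
    proof (cases "x \<in> A")
      case True
      then have "2 * int d dvd (\<sigma> y - \<sigma> x - int d) + (\<sigma> x - \<sigma> u)"
        using nd by (intro dvd_add) (auto simp: A_def)
      also have "(\<sigma> y - \<sigma> x - int d) + (\<sigma> x - \<sigma> u) = \<sigma> y - \<sigma> u - int d" by simp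
      finally have "y \<in> B" using x by (auto simp: B_def A_def)
      with True xy show ?thesis by blast
    next
      case False
      then have "2 * int d dvd (\<sigma> y - \<sigma> x - int d) + (\<sigma> x - \<sigma> u - int d) + 2 * int d"
        using nd x by (intro dvd_add) (auto simp: A_def B_def)
      also have "(\<sigma> y - \<sigma> x - int d) + (\<sigma> x - \<sigma> u - int d) + 2 * int d = \<sigma> y - \<sigma> u" by simp
      finally have "y \<in> A" using x by (auto simp: B_def A_def)
      with False x xy show ?thesis by (auto simp: insert_commute)
    qed
  qed
  ultimately show ?thesis unfolding bipartite_def by (metis ends_component)
qed

lemma diameter_component:
  assumes "u \<in> verts G"
  shows "diameter (component G u) = 2"
proof (rule antisym)
  have "distance (component G u) x y \<le> 2" if "reachable G u x" "reachable G u y" for x y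
  proof -
    have "x \<in> verts G" "y \<in> verts G" "reachable G x y"
      using that reachable_verts reachable_trans reachable_sym[OF wf] by metis+
    then have "int d dvd \<sigma> y - \<sigma> x" using reachable_iff by blast
    from short_walk[OF \<open>x \<in> verts G\<close> \<open>y \<in> verts G\<close> this] obtain es where
      es: "walk G x es y" "length es \<le> 2" .
    have "distance (component G u) x y \<le> enat (length es)"
      by (rule distance_le[OF walk_component[OF wf that(1) es(1)]])
    also have "\<dots> \<le> 2" using es(2) by (simp add: numeral_eq_enat)
    finally show ?thesis .
  qed
  then show "diameter (component G u) \<le> 2"
    unfolding diameter_def by (intro SUP_least) auto
next
  \<comment> \<open>The colour class of \<open>u\<close> has two members, so one of them is not
    \<open>u\<close>. Having the same colour it is not adjacent to \<open>u\<close>, and its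
    distance from \<open>u\<close> exceeds 1.\<close>
  obtain x y where "x \<in> verts G" "2 * int d dvd \<sigma> x - \<sigma> u" "y \<in> verts G"
    "2 * int d dvd \<sigma> y - \<sigma> u" "x \<noteq> y" by (rule class_obtains)
  then obtain v where v: "v \<in> verts G" "2 * int d dvd \<sigma> v - \<sigma> u" "v \<noteq> u" by metis
  have rv: "reachable G u v" using reachable_iff[OF assms v(1)] v(2) dvd_mult_right by blast
  have "\<not> distance (component G u) u v \<le> enat 1"
  proof
    assume "distance (component G u) u v \<le> enat 1"
    then obtain es where es: "walk (component G u) u es v" "length es \<le> 1" by (rule distance_leD)
    then have "length es \<noteq> 0" using v(3) by auto
    with es(2) obtain e where "es = [e]" by (cases es) auto
    with es(1) have "adjacent G u v"
      by (auto simp: adjacent_def induced_subgraph_def)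
    from dvd_diff[OF v(2) adjacent_dvd[OF this]] show False using not_dvd_d by simp
  qed
  then have "2 \<le> distance (component G u) u v"
    by (cases "distance (component G u) u v") (auto simp: numeral_eq_enat)
  also have "\<dots> \<le> diameter (component G u)"
    unfolding diameter_def using rv reachable_refl[OF assms]
    by (intro SUP_upper2[of u] SUP_upper) auto
  finally show "2 \<le> diameter (component G u)" .
qed

text \<open>Two vertices of the colour of \<open>u\<close> and two of the opposite colour span a
  4-cycle. Shorter closed paths are excluded: odd lengths by the colouring, length 2 by the absence
  of parallel edges.\<close>

lemma girth_component:
  assumes "u \<in> verts G"
  shows "girth (component G u) = 4"
proof (rule antisym)
  obtain a b where "a \<in> verts G" "2 * int d dvd \<sigma> a - \<sigma> u" "b \<in> verts G"
    "2 * int d dvd \<sigma> b - \<sigma> u" "a \<noteq> b" by (rule class_obtains[of "\<sigma> u"])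
  then obtain x where x: "x \<in> verts G" "2 * int d dvd \<sigma> x - \<sigma> u" "x \<noteq> u" by metis
  obtain y z where yz: "y \<in> verts G" "2 * int d dvd \<sigma> y - (\<sigma> u + int d)" "z \<in> verts G"
    "2 * int d dvd \<sigma> z - (\<sigma> u + int d)" "y \<noteq> z" by (rule class_obtains)
  have adj: "adjacent G a b" if "a \<in> {u, x}" "b \<in> {y, z}" for a b
  proof -
    have "2 * int d dvd \<sigma> a - \<sigma> u" "2 * int d dvd \<sigma> b - (\<sigma> u + int d)" "a \<in> verts G" "b \<in> verts G"
      using that x yz assms by auto
    then show ?thesis
      using dvd_diff[of "2 * int d" "\<sigma> b - (\<sigma> u + int d)" "\<sigma> a - \<sigma> u"] adjacent_iff[of a b]
      by (simp add: algebra_simps)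
  qed
  obtain e1 where e1: "e1 \<in> edges G" "ends G e1 = {u, y}"
    using adj[of u y] by (auto simp: adjacent_def)
  obtain e2 where e2: "e2 \<in> edges G" "ends G e2 = {x, y}"
    using adj[of x y] by (auto simp: adjacent_def)
  obtain e3 where e3: "e3 \<in> edges G" "ends G e3 = {x, z}"
    using adj[of x z] by (auto simp: adjacent_def)
  obtain e4 where e4: "e4 \<in> edges G" "ends G e4 = {u, z}"
    using adj[of u z] by (auto simp: adjacent_def)
  have "walk G z [e4] u" using e4 yz assms by (auto simp: insert_commute)
  then have "walk G x [e3, e4] u" using e3 x by (subst walk_Cons_iff) blast
  moreover have "ends G e2 = {y, x}" using e2 by (simp add: insert_commute)
  ultimately have "walk G y [e2, e3, e4] u" using e2 yz by (subst walk_Cons_iff) blast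
  then have "walk G u [e1, e2, e3, e4] u" using e1 assms by (subst walk_Cons_iff) blast
  then have w: "walk (component G u) u [e1, e2, e3, e4] u"
    by (rule walk_component[OF wf reachable_refl[OF assms]])
  have "e1 \<noteq> e2" "e2 \<noteq> e3" "e3 \<noteq> e4"
    using e1 e2 e3 e4 x yz by (auto simp: doubleton_eq_iff)
  then have "girth (component G u) \<le> enat (length [e1, e2, e3, e4])"
    by (intro girth_le[OF w]) auto
  also have "length [e1, e2, e3, e4] = 4" by simp
  finally show "girth (component G u) \<le> 4" by (simp add: numeral_eq_enat)
next
  show "4 \<le> girth (component G u)"
    unfolding girth_def
  proof (rule Inf_greatest)
    fix l assume "l \<in> {enat (length es) |v es. es \<noteq> [] \<and> walk (component G u) v es v \<and> distinct_adj es}"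
    then obtain v es where es: "l = enat (length es)" "es \<noteq> []" "walk (component G u) v es v"
      "distinct_adj es" by blast
    have w: "walk G v es v" by (rule walk_componentD[OF es(3)])
    have ev: "even (length es)"
    proof (rule ccontr)
      assume "odd (length es)"
      then obtain m where "length es = 2 * m + 1" by (rule oddE)
      then have "2 * int d dvd - int d - 2 * int d * int m"
        using walk_colour[OF w] by (simp add: algebra_simps)
      then have "2 * int d dvd (- int d - 2 * int d * int m) + 2 * int d * int m"
        by (intro dvd_add) auto
      then show False using not_dvd_d by simp
    qed
    have "length es \<noteq> 2"
    proof
      assume "length es = 2"
      then obtain e f where ef: "es = [e, f]" by (auto simp: numeral_2_eq_2 length_Suc_conv)
      then have "ends G e = ends G f" "e \<in> edges G" "f \<in> edges G" using w by auto
      then have "e = f" using inj_ends by (simp add: inj_on_eq_iff)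
      then show False using es(4) ef by simp
    qed
    moreover have "length es \<noteq> 0" "length es \<noteq> 1" "length es \<noteq> 3" using ev es(2) by auto
    ultimately have "4 \<le> length es" by linarith
    then show "4 \<le> l" using es(1) by (simp add: numeral_eq_enat)
  qed
qed

lemma degree_component:
  assumes "u \<in> verts G" "v \<in> verts (component G u)"
  shows "3 \<le> degree (component G u) v"
proof -
  let ?N = "{x \<in> verts G. 2 * int d dvd \<sigma> x - (\<sigma> v + int d)}"
  have v: "v \<in> verts G" "reachable G u v" using assms(2) by (auto dest: reachable_verts)
  have "\<exists>e. e \<in> edges (component G u) \<and> ends G e = {v, x}" if "x \<in> ?N" for x
  proof -
    have "adjacent G v x" using that adjacent_iff[OF v(1), of x] by (simp add: algebra_simps)
    then show ?thesis using edge_in_component(1)[OF wf _ _ v(2)] unfolding adjacent_def by blast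
  qed
  then obtain g where g: "\<And>x. x \<in> ?N \<Longrightarrow> g x \<in> edges (component G u) \<and> ends G (g x) = {v, x}"
    by metis
  have inj: "inj_on g ?N"
  proof (rule inj_onI)
    fix x y assume "x \<in> ?N" "y \<in> ?N" "g x = g y"
    then have "{v, x} = {v, y}" using g by metis
    then show "x = y" by (auto simp: doubleton_eq_iff)
  qed
  let ?E = "{e \<in> edges (component G u). v \<in> ends (component G u) e}"
  have sub: "g ` ?N \<subseteq> ?E" using g by auto
  have ends_E: "ends G e \<in> (\<lambda>x. {v, x}) ` ?N" if "e \<in> ?E" for e
  proof -
    from that have e: "e \<in> edges G" "v \<in> ends G e" by (auto simp: induced_subgraph_def)
    then obtain x where x: "ends G e = {v, x}" using wf unfolding wellformed_def by fastforce
    then have "adjacent G v x" using e by (auto simp: adjacent_def)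
    then have "x \<in> ?N" using adjacent_verts[OF wf] adjacent_dvd by (fastforce simp: algebra_simps)
    with x show ?thesis by blast
  qed
  \<comment> \<open>\<open>card\<close> is 0 on infinite sets, so a class with at least three
    elements is finite. Through the ends, so is the set of edges at \<open>v\<close>, as
    \<open>card_mono\<close> requires.\<close>
  have "finite ?N" using classes[of "\<sigma> v + int d"] by (auto intro: card_ge_0_finite)
  moreover have "inj_on (ends G) ?E"
    by (rule inj_on_subset[OF inj_ends]) (auto simp: induced_subgraph_def)
  ultimately have "finite ?E"
    using ends_E by (intro inj_on_finite[of "ends G" ?E "(\<lambda>x. {v, x}) ` ?N"]) auto
  have "3 \<le> card ?N" by (rule classes)
  also have "card ?N = card (g ` ?N)" using inj by (simp add: card_image)
  also have "\<dots> \<le> card ?E" by (rule card_mono[OF \<open>finite ?E\<close> sub])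
  finally show ?thesis by (simp add: degree_def)
qed

text \<open>Translating colours by \<open>\<sigma> v - \<sigma> u\<close> preserves their
  differences and hence adjacency. As an edge is determined by its ends, the map on vertices
  dictates the map on edges.\<close>

lemma isomorphic_components:
  assumes "u \<in> verts G" "v \<in> verts G"
  shows "graph_isomorphic (component G u) (component G v)"
proof -
  obtain f where bij: "bij_betw f (verts G) (verts G)"
    and f: "\<And>x. x \<in> verts G \<Longrightarrow> 2 * int d dvd \<sigma> (f x) - \<sigma> x - (\<sigma> v - \<sigma> u)"
    using shift by metis
  have f_in: "f x \<in> verts G" if "x \<in> verts G" for x using bij that by (rule bij_betwE[rule_format])
  have vert: "int d dvd \<sigma> (f x) - \<sigma> v \<longleftrightarrow> int d dvd \<sigma> x - \<sigma> u" if "x \<in> verts G" for x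
  proof -
    have "int d dvd \<sigma> (f x) - \<sigma> x - (\<sigma> v - \<sigma> u)" using f[OF that] dvd_mult_right by blast
    from dvd_add_right_iff[OF this, of "\<sigma> x - \<sigma> u"] show ?thesis by simp
  qed
  have adj: "adjacent G (f x) (f y) \<longleftrightarrow> adjacent G x y" if "x \<in> verts G" "y \<in> verts G" for x y
  proof -
    have "2 * int d dvd (\<sigma> (f y) - \<sigma> y - (\<sigma> v - \<sigma> u)) - (\<sigma> (f x) - \<sigma> x - (\<sigma> v - \<sigma> u))"
      by (intro dvd_diff[OF f f] that)
    from dvd_add_right_iff[OF this, of "\<sigma> y - \<sigma> x - int d"]
    have "2 * int d dvd \<sigma> (f y) - \<sigma> (f x) - int d \<longleftrightarrow> 2 * int d dvd \<sigma> y - \<sigma> x - int d"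
      by (simp add: algebra_simps)
    then show ?thesis using that f_in adjacent_iff by simp
  qed
  have bijf: "bij_betw f (verts (component G u)) (verts (component G v))"
    unfolding verts_component_eq[OF assms(1)] verts_component_eq[OF assms(2)]
    by (rule bij_betw_Collect[OF bij]) (rule vert)
  let ?E = "\<lambda>u. edges (component G u)"
  have edge_ex: "\<exists>g. g \<in> ?E v \<and> ends G g = f ` ends G e" if e: "e \<in> ?E u" for e
  proof -
    from e have "e \<in> edges G" by (simp add: induced_subgraph_def)
    then obtain x y where xy: "ends G e = {x, y}" "x \<in> verts G" "y \<in> verts G"
      using wf unfolding wellformed_def by blast
    then have "adjacent G (f x) (f y)" using adj \<open>e \<in> edges G\<close> by (auto simp: adjacent_def)
    then obtain g where g: "g \<in> edges G" "ends G g = {f x, f y}" by (auto simp: adjacent_def)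
    have "x \<in> verts (component G u)" using e xy by (auto simp: induced_subgraph_def)
    then have "reachable G v (f x)" using bijf by (auto dest: bij_betwE)
    from edge_in_component(1)[OF wf g this] g xy show ?thesis by auto
  qed
  then obtain g where g: "\<And>e. e \<in> ?E u \<Longrightarrow> g e \<in> ?E v \<and> ends G (g e) = f ` ends G e" by metis
  have E_sub: "?E x \<subseteq> edges G" "\<And>e. e \<in> ?E x \<Longrightarrow> ends G e \<subseteq> verts (component G x)" for x
    by (auto simp: induced_subgraph_def)
  have "bij_betw g (?E u) (?E v)"
    unfolding bij_betw_def
  proof (intro conjI equalityI subsetI)
    show "inj_on g (?E u)"
    proof (rule inj_onI)
      fix e h assume e: "e \<in> ?E u" "h \<in> ?E u" "g e = g h"
      then have "f ` ends G e = f ` ends G h" using g by metis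
      then have "ends G e = ends G h"
        using E_sub(2)[OF e(1)] E_sub(2)[OF e(2)] bijf
        by (metis bij_betw_imp_inj_on inj_on_image_eq_iff)
      then show "e = h" using inj_ends E_sub(1) e by (meson inj_onD subsetD)
    qed
    fix h assume h: "h \<in> ?E v"
    have hG: "h \<in> edges G" using h by (rule subsetD[OF E_sub(1)])
    then obtain x' y' where xy': "ends G h = {x', y'}" "x' \<in> verts G" "y' \<in> verts G"
      using wf unfolding wellformed_def by blast
    have "{x', y'} \<subseteq> f ` verts (component G u)"
      using E_sub(2)[OF h] xy' bijf by (simp add: bij_betw_imp_surj_on)
    then obtain x y where xy: "x' = f x" "y' = f y" "x \<in> verts (component G u)" "y \<in> verts (component G u)"
      by auto
    then have xyG: "x \<in> verts G" "y \<in> verts G" by (auto dest: reachable_verts)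
    have "adjacent G (f x) (f y)" using xy xy' hG by (auto simp: adjacent_def)
    then have "adjacent G x y" using adj xyG by blast
    then obtain e where e: "e \<in> edges G" "ends G e = {x, y}" by (auto simp: adjacent_def)
    have "e \<in> ?E u" by (rule edge_in_component(1)[OF wf e]) (use xy in simp)
    moreover have "ends G (g e) = ends G h" using g[OF calculation] e xy xy' by simp
    then have "g e = h" using g[OF calculation] hG E_sub(1) inj_ends by (meson inj_onD subsetD)
    ultimately show "h \<in> g ` ?E u" by blast
  next
    fix h assume "h \<in> g ` ?E u"
    then obtain e where "h = g e" "e \<in> ?E u" by (rule imageE)
    with g[of e] show "h \<in> ?E v" by simp
  qed
  with bijf g show ?thesis
    unfolding graph_isomorphic_def ends_component by (intro exI[of _ f] exI[of _ g] conjI ballI) auto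
qed

end

section \<open>The star graph of a cyclic presentation\<close>

lemma theta_pow:
  assumes "set w \<subseteq> {..<n} \<times> UNIV"
  shows "(theta n ^^ j) w = map (apfst (\<lambda>i. (i + j) mod n)) w"
proof (induction j)
  case 0
  have "map (apfst (\<lambda>i. (i + 0) mod n)) w = map id w"
    by (rule map_cong) (use assms in auto)
  then show ?case by simp
next
  case (Suc j)
  have "(theta n ^^ Suc j) w = theta n (map (apfst (\<lambda>i. (i + j) mod n)) w)"
    using Suc by simp
  also have "\<dots> = map (apfst (\<lambda>i. (i + Suc j) mod n)) w"
    by (auto simp: theta_def mod_Suc_eq)
  finally show ?case .
qed

locale cyclic_word =
  fixes n :: nat and w :: "nat word"
  assumes n_pos: "0 < n"
    and letters: "set w \<subseteq> {..<n} \<times> UNIV"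
    and cyc_red: "cyclically_reduced w"
    and len: "2 \<le> length w"
begin

text \<open>Subscripts are kept as integers and reduced only here, so that shifts are additions and
  coincidence of vertices is divisibility by \<open>n\<close>.\<close>

definition vertex :: "bool \<Rightarrow> int \<Rightarrow> nat letter" where
  "vertex b i = (nat (i mod int n), b)"

definition sub :: "nat \<Rightarrow> int" where
  "sub p = int (fst (w ! (p mod length w)))"

definition sgn :: "nat \<Rightarrow> bool" where
  "sgn p = snd (w ! (p mod length w))"

definition diff :: "nat \<Rightarrow> int" where
  "diff p = sub (Suc p) - sub p"

definition src :: "int \<Rightarrow> nat \<Rightarrow> nat letter" where
  "src j p = vertex (sgn p) (sub p + j)"

text \<open>In a word \<open>x y\<inverse> u\<close> the edge runs from the first letter to the
  inverse of the second; hence the negated sign.\<close>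

definition tgt :: "int \<Rightarrow> nat \<Rightarrow> nat letter" where
  "tgt j p = vertex (\<not> sgn (Suc p)) (sub (Suc p) + j)"

abbreviation relator :: "nat \<Rightarrow> nat word" where
  "relator j \<equiv> (theta n ^^ j) w"

definition edge :: "nat \<Rightarrow> nat \<Rightarrow> nat word set" where
  "edge j p = {rotate p (relator j), edge_partner (rotate p (relator j))}"

abbreviation G :: "(nat letter, nat word set) multigraph" where
  "G \<equiv> star_graph (cyclic_presentation n w)"

section \<open>Vertices, relators and edges of the star graph\<close>

lemma length_pos: "0 < length w"
  using len by linarith

lemma vertex_eq_iff: "vertex b i = vertex c l \<longleftrightarrow> b = c \<and> int n dvd i - l"
  using n_pos by (auto simp: vertex_def mod_eq_dvd_iff[symmetric] nat_eq_iff2)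

lemma vertex_mod_eq: "int n dvd i - l \<Longrightarrow> vertex b i = vertex b l"
  by (simp add: vertex_eq_iff)

lemma inv_letter_vertex: "inv_letter (vertex b i) = vertex (\<not> b) i"
  by (simp add: vertex_def inv_letter_def)

lemma vertex_in_verts: "vertex b i \<in> verts G"
  using n_pos by (simp add: vertex_def star_graph_def cyclic_presentation_def nat_less_iff)

lemma verts_cases:
  assumes "v \<in> verts G"
  obtains b i where "v = vertex b i"
proof -
  have "fst v < n" using assms by (auto simp: star_graph_def cyclic_presentation_def)
  then have "v = vertex (snd v) (int (fst v))" by (cases v) (simp add: vertex_def)
  then show ?thesis by (rule that)
qed

lemma length_relator [simp]: "length (relator j) = length w"
  by (simp add: theta_pow[OF letters])

lemma relator_neq_Nil: "relator j \<noteq> []"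
  using length_relator[of j] length_pos by fastforce

lemma relator_nth: "relator j ! (p mod length w) = vertex (sgn p) (sub p + int j)"
proof -
  have "p mod length w < length w" using len by (intro mod_less_divisor) linarith
  then show ?thesis
    by (cases "w ! (p mod length w)")
      (simp add: theta_pow[OF letters] vertex_def sgn_def sub_def nat_mod_distrib flip: of_nat_add of_nat_mod)
qed

lemma rotate_relator_nth:
  "i < length w \<Longrightarrow> rotate p (relator j) ! i = vertex (sgn (p + i)) (sub (p + i) + int j)"
  using relator_nth[of j "p + i"] by (simp add: nth_rotate)

lemma cyclically_reduced_relator: "cyclically_reduced (relator j)"
proof -
  \<comment> \<open>Membership in the carrier includes reducedness, which the automorphism
    \<open>theta n\<close> therefore passes on. What remains is the step from the last letter to the
    first.\<close>
  have "relator j \<in> carrier (free_group {..<n})"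
  proof (induction j)
    case 0
    show ?case using letters cyc_red by (simp add: free_group_def cyclically_reduced_def)
  next
    case (Suc j)
    have "theta n \<in> hom (free_group {..<n}) (free_group {..<n})"
      using theta_iso by (auto simp: iso_def)
    with Suc show ?case by (simp add: hom_def Pi_iff)
  qed
  then have red: "reduced (relator j)" by (simp add: free_group_def)
  let ?l = "length w - 1"
  have ne: "relator j \<noteq> []" "w \<noteq> []" using relator_neq_Nil length_pos by auto
  have "hd (relator j) = relator j ! (0 mod length w)" "last (relator j) = relator j ! (?l mod length w)"
    using ne by (simp_all add: hd_conv_nth last_conv_nth)
  then have "hd (relator j) = vertex (sgn 0) (sub 0 + int j)"
    "last (relator j) = vertex (sgn ?l) (sub ?l + int j)"
    unfolding relator_nth by simp_all
  moreover have "w ! 0 = vertex (sgn 0) (sub 0)" "w ! ?l = vertex (sgn ?l) (sub ?l)"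
    using relator_nth[of 0 0] relator_nth[of 0 ?l] ne by simp_all
  moreover have "w ! 0 \<noteq> inv_letter (w ! ?l)"
    using cyc_red ne by (simp add: cyclically_reduced_def hd_conv_nth last_conv_nth)
  ultimately show ?thesis
    using red by (simp add: cyclically_reduced_def inv_letter_vertex vertex_eq_iff)
qed

lemma relator_in_carrier: "relator j \<in> carrier (free_group {..<n})"
proof -
  have "set (relator j) \<subseteq> {..<n} \<times> UNIV"
    using n_pos by (auto simp: theta_pow[OF letters])
  then show ?thesis
    using cyclically_reduced_relator by (simp add: free_group_def cyclically_reduced_def)
qed

lemma gens_rels [simp]:
  "gens (cyclic_presentation n w) = {..<n}"
  "rels (cyclic_presentation n w) = relator ` {..<n}"
  by (auto simp: cyclic_presentation_def)

text \<open>Of the two words that make up an edge, one is a rotation of a relator and the other a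
  rotation of its inverse, so rotations of the relators themselves suffice.\<close>

lemma edges_G: "edges G = (\<lambda>(j, p). edge j p) ` ({..<n} \<times> {..<length w})"
proof -
  have rot: "\<exists>p<length w. rotate i (relator j) = rotate p (relator j)" for i j
    using length_pos by (intro exI[of _ "i mod length w"]) (metis length_relator mod_less_divisor rotate_conv_mod)
  have "edges G = {{v, edge_partner v} |v. v \<in> symmetrized_rels (cyclic_presentation n w) \<and> 2 \<le> length v}"
    by (simp add: star_graph_def)
  also have "\<dots> = (\<lambda>(j, p). edge j p) ` ({..<n} \<times> {..<length w})"
  proof (intro equalityI subsetI)
    fix e assume "e \<in> {{v, edge_partner v} |v. v \<in> symmetrized_rels (cyclic_presentation n w) \<and> 2 \<le> length v}"
    then obtain v where v: "e = {v, edge_partner v}" "v \<in> symmetrized_rels (cyclic_presentation n w)"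
      by blast
    then obtain i j where ij: "j < n" "v = rotate i (relator j) \<or> v = rotate i (inv_word (relator j))"
      by (auto simp: symmetrized_rels_def)
    have "\<exists>p. e = edge j p"
      using ij(2)
    proof
      assume "v = rotate i (relator j)"
      then show ?thesis using v by (auto simp: edge_def)
    next
      assume vi: "v = rotate i (inv_word (relator j))"
      then have lv: "2 \<le> length v" using len by simp
      have "edge_partner v = rotate (length w - 2) (inv_word v)"
        using edge_partner_rotate[OF lv] vi by simp
      then obtain p where "edge_partner v = rotate p (relator j)"
        by (auto simp: vi inv_word_rotate rotate_rotate)
      moreover have "v = edge_partner (edge_partner v)"
        using edge_partner_edge_partner[OF lv] by simp
      ultimately show ?thesis using v by (auto simp: edge_def insert_commute)
    qed
    then obtain p where "e = edge j p" by blast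
    with rot[of p j] obtain q where "q < length w" "e = edge j q" by (auto simp: edge_def)
    with ij(1) show "e \<in> (\<lambda>(j, p). edge j p) ` ({..<n} \<times> {..<length w})" by force
  next
    fix e assume "e \<in> (\<lambda>(j, p). edge j p) ` ({..<n} \<times> {..<length w})"
    then obtain j p where jp: "j < n" "e = edge j p" by auto
    then have "rotate p (relator j) \<in> symmetrized_rels (cyclic_presentation n w)"
      unfolding symmetrized_rels_def by auto
    moreover have "2 \<le> length (rotate p (relator j))" using len by simp
    ultimately show "e \<in> {{v, edge_partner v} |v. v \<in> symmetrized_rels (cyclic_presentation n w) \<and> 2 \<le> length v}"
      using jp unfolding edge_def by blast
  qed
  finally show ?thesis .
qed

lemma ends_edge: "ends G (edge j p) = {src (int j) p, tgt (int j) p}"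
proof -
  let ?v = "rotate p (relator j)"
  have "?v ! 0 = src (int j) p" "?v ! 1 = inv_letter (tgt (int j) p)"
    using rotate_relator_nth[OF length_pos, of p j] rotate_relator_nth[of 1 p j] len
    by (auto simp: src_def tgt_def inv_letter_vertex)
  moreover have "2 \<le> length ?v" using len by simp
  then have "hd ?v = ?v ! 0" "hd (edge_partner ?v) = inv_letter (?v ! 1)"
    by (cases ?v rule: edge_partner.cases; simp)+
  ultimately show ?thesis by (simp add: edge_def star_graph_def)
qed

lemma src_cong: "int n dvd j - j' \<Longrightarrow> src j p = src j' p"
  and tgt_cong: "int n dvd j - j' \<Longrightarrow> tgt j p = tgt j' p"
  by (simp_all add: src_def tgt_def vertex_eq_iff)

lemma wellformed_G: "wellformed G"
  unfolding wellformed_def edges_G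
  by (auto simp: ends_edge src_def tgt_def intro!: bexI vertex_in_verts)

lemma edge_obtains:
  assumes "p < length w"
  obtains e where "e \<in> edges G" "ends G e = {src j p, tgt j p}"
proof -
  define i where "i = nat (j mod int n)"
  have i: "i < n" "int i = j mod int n" using n_pos by (simp_all add: i_def nat_less_iff)
  then have "int n dvd int i - j" by (simp add: mod_eq_dvd_iff[symmetric])
  then have "ends G (edge i p) = {src j p, tgt j p}"
    using ends_edge[of i p] src_cong[of "int i" j] tgt_cong[of "int i" j] by simp
  moreover have "edge i p \<in> edges G" using i assms by (auto simp: edges_G)
  ultimately show ?thesis using that by blast
qed

text \<open>\<open>joined b c d\<close> says that the vertices \<open>x\<^sub>i\<close> (or \<open>x\<^sub>i\<inverse>\<close>, according to \<open>b\<close>) and \<open>x\<^sub>i\<^sub>+\<^sub>d\<close> (according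
  to \<open>c\<close>) are adjacent.\<close>

definition joined :: "bool \<Rightarrow> bool \<Rightarrow> int \<Rightarrow> bool" where
  "joined b c d \<longleftrightarrow> (\<exists>p<length w.
    (sgn p = b \<and> sgn (Suc p) = (\<not> c) \<and> int n dvd d - diff p) \<or>
    (sgn p = c \<and> sgn (Suc p) = (\<not> b) \<and> int n dvd d + diff p))"

text \<open>All shifts of an edge are edges, so only the difference of the subscripts matters. The
  two disjuncts of \<open>joined\<close> are the two directions in which an edge can be
  read.\<close>

lemma adjacent_vertex_iff: "adjacent G (vertex b i) (vertex c l) \<longleftrightarrow> joined b c (l - i)"
proof
  assume "adjacent G (vertex b i) (vertex c l)"
  then obtain e where "e \<in> edges G" "ends G e = {vertex b i, vertex c l}"
    by (auto simp: adjacent_def)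
  then obtain j p where p: "p < length w" "{src (int j) p, tgt (int j) p} = {vertex b i, vertex c l}"
    using ends_edge by (auto simp: edges_G)
  from p(2) consider "src (int j) p = vertex b i" "tgt (int j) p = vertex c l"
    | "src (int j) p = vertex c l" "tgt (int j) p = vertex b i" by (auto simp: doubleton_eq_iff)
  then show "joined b c (l - i)"
  proof cases
    case 1
    then have 1: "sgn p = b" "sgn (Suc p) = (\<not> c)" "int n dvd sub p + int j - i"
      "int n dvd sub (Suc p) + int j - l" by (auto simp: src_def tgt_def vertex_eq_iff)
    have "int n dvd l - i - diff p"
      using dvd_diff[OF 1(3,4)] by (simp add: diff_def algebra_simps)
    with 1 p(1) show ?thesis unfolding joined_def by blast
  next
    case 2
    then have 2: "sgn p = c" "sgn (Suc p) = (\<not> b)" "int n dvd sub p + int j - l"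
      "int n dvd sub (Suc p) + int j - i" by (auto simp: src_def tgt_def vertex_eq_iff)
    have "int n dvd l - i + diff p"
      using dvd_diff[OF 2(4,3)] by (simp add: diff_def algebra_simps)
    with 2 p(1) show ?thesis unfolding joined_def by blast
  qed
next
  assume "joined b c (l - i)"
  then obtain p where p: "p < length w" and
    "(sgn p = b \<and> sgn (Suc p) = (\<not> c) \<and> int n dvd l - i - diff p) \<or>
     (sgn p = c \<and> sgn (Suc p) = (\<not> b) \<and> int n dvd l - i + diff p)"
    unfolding joined_def by blast
  from this(2) show "adjacent G (vertex b i) (vertex c l)"
  proof
    assume *: "sgn p = b \<and> sgn (Suc p) = (\<not> c) \<and> int n dvd l - i - diff p"
    have "tgt (i - sub p) p = vertex c l"
      unfolding tgt_def using * dvd_minus_iff[of "int n" "l - i - diff p"]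
      by (simp add: vertex_eq_iff diff_def algebra_simps)
    moreover have "src (i - sub p) p = vertex b i" using * by (simp add: src_def)
    ultimately show ?thesis
      using edge_obtains[OF p, of "i - sub p"] unfolding adjacent_def by metis
  next
    assume *: "sgn p = c \<and> sgn (Suc p) = (\<not> b) \<and> int n dvd l - i + diff p"
    have "tgt (l - sub p) p = vertex b i"
      unfolding tgt_def using * by (simp add: vertex_eq_iff diff_def algebra_simps)
    moreover have "src (l - sub p) p = vertex c l" using * by (simp add: src_def)
    ultimately have "adjacent G (vertex c l) (vertex b i)"
      using edge_obtains[OF p, of "l - sub p"] unfolding adjacent_def by metis
    then show ?thesis by (rule adjacent_sym)
  qed
qed

lemma joined_minus: "joined c b (- d) \<longleftrightarrow> joined b c d"
  using adjacent_vertex_iff[of b 0 c d] adjacent_vertex_iff[of c d b 0] adjacent_sym by force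

lemma joined_cong:
  assumes "int n dvd d - d'"
  shows "joined b c d \<longleftrightarrow> joined b c d'"
  using adjacent_vertex_iff[of b 0 c d] adjacent_vertex_iff[of b 0 c d'] vertex_mod_eq[OF assms] by simp

text \<open>Stated for pairs of a shift and a position instead of edges: besides parallel edges it
  excludes that two such pairs describe the same edge. Counting positions relies on this stronger
  form.\<close>

definition simple :: bool where
  "simple \<longleftrightarrow> (\<forall>j j'. \<forall>p<length w. \<forall>p'<length w.
    {src j p, tgt j p} = {src j' p', tgt j' p'} \<longrightarrow> p = p' \<and> int n dvd j - j')"

lemma simpleD:
  assumes simple "{src j p, tgt j p} = {src j' p', tgt j' p'}" "p < length w" "p' < length w"
  shows "p = p'" "int n dvd j - j'"
  using assms unfolding simple_def by blast+

lemma inj_on_ends_if_simple: "simple \<Longrightarrow> inj_on (ends G) (edges G)"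
proof (rule inj_onI)
  fix e f assume simple: simple and "e \<in> edges G" "f \<in> edges G" and ends: "ends G e = ends G f"
  then obtain i p j q where e: "e = edge i p" "i < n" "p < length w"
    and f: "f = edge j q" "j < n" "q < length w" by (auto simp: edges_G)
  have "{src (int i) p, tgt (int i) p} = {src (int j) q, tgt (int j) q}"
    using ends by (simp add: e(1) f(1) ends_edge)
  from simpleD[OF simple this e(3) f(3)] have "p = q" "int n dvd int i - int j" .
  then have "int i mod int n = int j mod int n" by (simp add: mod_eq_dvd_iff)
  then have "i = j" using e(2) f(2) by simp
  with \<open>p = q\<close> e f show "e = f" by simp
qed

lemma simple_if_inj_on:
  assumes inj: "inj_on (ends G) (edges G)"
    and edge: "\<And>i j p q. i < n \<Longrightarrow> j < n \<Longrightarrow> p < length w \<Longrightarrow> q < length w \<Longrightarrow>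
      edge i p = edge j q \<Longrightarrow> i = j \<and> p = q"
  shows simple
  unfolding simple_def
proof (intro allI impI)
  fix j j' p p'
  assume p: "p < length w" "p' < length w" and eq: "{src j p, tgt j p} = {src j' p', tgt j' p'}"
  let ?i = "\<lambda>j. nat (j mod int n)"
  have i: "?i j < n" "int n dvd int (?i j) - j" for j
    using n_pos by (simp_all add: nat_less_iff mod_eq_dvd_iff[symmetric])
  have E: "ends G (edge (?i j) p) = {src j p, tgt j p}" for j p
    using ends_edge src_cong[OF i(2)] tgt_cong[OF i(2)] by simp
  have "ends G (edge (?i j) p) = ends G (edge (?i j') p')" using E eq by simp
  moreover have "edge (?i j) p \<in> edges G" "edge (?i j') p' \<in> edges G"
    using i p by (auto simp: edges_G)
  ultimately have "edge (?i j) p = edge (?i j') p'" using inj by (simp add: inj_on_eq_iff)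
  then have "?i j = ?i j'" "p = p'" using edge i(1) p by metis+
  then show "p = p' \<and> int n dvd j - j'"
    using n_pos by (simp add: eq_nat_nat_iff mod_eq_dvd_iff[symmetric])
qed

text \<open>Equal edges give relators that are rotations of each other or of their inverses, hence
  freely conjugate up to inversion, and non-redundancy makes the shifts equal. Distinct positions
  would then yield a nontrivial rotation fixing the relator and so make \<open>w\<close> a proper
  power, while a cyclically reduced word is never a rotation of its own inverse.\<close>

lemma edge_inj:
  assumes nr: "non_redundant (cyclic_presentation n w)"
    and npp: "\<not> proper_power (free_group {..<n}) w"
    and ij: "i < n" "j < n" and pq: "p < length w" "q < length w"
    and eq: "edge i p = edge j q"
  shows "i = j \<and> p = q"
proof -
  let ?F = "free_group {..<n}"
  have relator_inj: "l = m" if "relator l = relator m" "l < n" "m < n" for l m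
  proof -
    have "vertex (sgn 0) (sub 0 + int l) = vertex (sgn 0) (sub 0 + int m)"
      using relator_nth[of l 0] relator_nth[of m 0] that(1) by simp
    then have "int l mod int n = int m mod int n" by (simp add: vertex_eq_iff mod_eq_dvd_iff)
    then show ?thesis using that by simp
  qed
  have not_conj: False if "i \<noteq> j" "conjugate_in ?F (relator i) (relator j) \<or>
      conjugate_in ?F (relator i) (inv_word (relator j))"
  proof -
    have "relator i \<noteq> relator j" using relator_inj that(1) ij by blast
    moreover have "\<not> freely_redundant (cyclic_presentation n w) (relator i)"
      using nr ij(1) by (simp add: non_redundant_def)
    ultimately show False
      using that(2) ij(2) unfolding freely_redundant_def Let_def gens_rels
        inv_free_group[OF relator_in_carrier, symmetric] by blast
  qed
  have rot_i: "relator i = rotate m u" if "rotate p (relator i) = rotate l u" "m = length w - p + l" for m l u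
    using that pq rotate_rotate[of "length w - p" p "relator i"] rotate_rotate[of "length w - p" l u]
      rotate_id[of "length w" "relator i"] by simp
  have cri: "reduced (relator i)" using cyclically_reduced_relator by (simp add: cyclically_reduced_def)
  have lv: "2 \<le> length (rotate q (relator j))" using len by simp
  from eq consider (same) "rotate p (relator i) = rotate q (relator j)"
    | (opp) "rotate p (relator i) = edge_partner (rotate q (relator j))"
    by (auto simp: edge_def)
  then show ?thesis
  proof cases
    case same
    have ri: "relator i = rotate (length w - p + q) (relator j)" by (rule rot_i[OF same refl])
    then have "conjugate_in ?F (relator i) (relator j)"
      using conjugate_in_rotate[OF relator_in_carrier[of j]] cri by metis
    then have "i = j" using not_conj by blast
    moreover have "p = q"
    proof (rule ccontr)
      assume "p \<noteq> q"
      \<comment> \<open>\<open>m\<close> is not 0, since \<open>length w - p + q\<close> lies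
        strictly between 0 and \<open>2 * length w\<close> and equals \<open>length w\<close> only
        for \<open>p = q\<close>.\<close>
      define m where "m = (length w - p + q) mod length w"
      have m: "0 < m" "m < length w"
      proof -
        show "m < length w" unfolding m_def by (rule mod_less_divisor[OF length_pos])
        show "0 < m"
        proof (rule ccontr)
          assume "\<not> 0 < m"
          then have "length w dvd length w - p + q" by (simp add: m_def mod_eq_0_iff_dvd)
          then obtain c where "length w - p + q = length w * c" by blast
          moreover have "0 < length w - p + q" "length w - p + q < length w * 2" using pq by linarith+
          ultimately have "c = 1" by (cases c rule: nat.exhaust) auto
          then show False using \<open>length w - p + q = length w * c\<close> \<open>p \<noteq> q\<close> pq by simp
        qed
      qed
      have "rotate m (relator j) = relator j"
        using ri \<open>i = j\<close> by (metis length_relator m_def rotate_conv_mod)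
      then have "relator j ! (r mod length w) = relator j ! ((m + r) mod length w)" for r
        by (metis add.commute length_relator mod_add_left_eq mod_less_divisor nth_rotate pq(1) less_nat_zero_code neq0_conv)
      \<comment> \<open>The shift by \<open>j\<close> adds the same amount to both subscripts and
        cancels, so the symmetry passes from the relator to \<open>w\<close>.\<close>
      then have vv: "vertex (sgn r) (sub r) = vertex (sgn (m + r)) (sub (m + r))" for r
        unfolding relator_nth by (metis (no_types) add_diff_cancel_right vertex_eq_iff)
      have "rotate m w = w"
      proof (rule nth_equalityI)
        fix r assume "r < length (rotate m w)"
        then show "rotate m w ! r = w ! r"
          using vv[of r] relator_nth[of 0 r] relator_nth[of 0 "m + r"] by (simp add: nth_rotate)
      qed simp
      moreover have "w \<in> carrier ?F" using relator_in_carrier[of 0] by simp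
      ultimately show False using proper_power_if_rotate_eq[OF _ _ m] npp by blast
    qed
    ultimately show ?thesis ..
  next
    case opp
    define l where "l = length w - 2 + (length w - q mod length w)"
    have "edge_partner (rotate q (relator j)) = rotate l (inv_word (relator j))"
      using edge_partner_rotate[OF lv] by (simp add: inv_word_rotate rotate_rotate l_def)
    then have ri: "relator i = rotate (length w - p + l) (inv_word (relator j))"
      using opp by (intro rot_i) auto
    have "inv_word (relator j) \<in> carrier ?F"
      using relator_in_carrier[of j] set_inv_word[of "relator j"]
      by (simp add: free_group_def reduced_inv_word)
    then have "conjugate_in ?F (relator i) (inv_word (relator j))"
      using conjugate_in_rotate cri ri by metis
    then have "i = j" using not_conj by blast
    have "inv_word (relator i) = rotate (length w - (length w - p + l) mod length w) (relator i)"
      using arg_cong[OF ri, of inv_word] \<open>i = j\<close> by (simp add: inv_word_rotate)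
    then show ?thesis
      using rotate_neq_inv_word[OF cyclically_reduced_relator relator_neq_Nil] by metis
  qed
qed

end

section \<open>Subscript differences\<close>

lemma count_image_mset_set_le_1_iff:
  assumes "finite S"
  shows "(\<forall>x. count (image_mset f (mset_set S)) x \<le> 1) \<longleftrightarrow> inj_on f S"
proof -
  have count: "count (image_mset f (mset_set S)) x = card {s \<in> S. f s = x}" for x
  proof -
    have "count (image_mset f (mset_set S)) x = (\<Sum>y | y \<in> S \<and> x = f y. count (mset_set S) y)"
      using assms by (simp add: count_image_mset')
    also have "\<dots> = (\<Sum>y | y \<in> S \<and> x = f y. 1)"
      by (rule sum.cong) (use assms in auto)
    finally show ?thesis by (simp add: eq_commute)
  qed
  show ?thesis
  proof
    assume le: "\<forall>x. count (image_mset f (mset_set S)) x \<le> 1"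
    show "inj_on f S"
    proof (rule inj_onI)
      fix s t assume st: "s \<in> S" "t \<in> S" "f s = f t"
      have "card {u \<in> S. f u = f t} \<le> Suc 0" using le count by simp
      then show "s = t" using st assms by (simp add: card_le_Suc0_iff_eq)
    qed
  next
    assume "inj_on f S"
    then have "card {s \<in> S. f s = x} \<le> Suc 0" for x
      using assms by (auto simp: card_le_Suc0_iff_eq inj_on_def)
    then show "\<forall>x. count (image_mset f (mset_set S)) x \<le> 1" using count by simp
  qed
qed

lemma card_residue_class:
  assumes "m dvd n" "0 < n"
  shows "card {x \<in> {0..<int n}. int m dvd x - r} = n div m"
proof -
  from assms obtain c where c: "n = m * c" "0 < m" "0 < c" by auto
  let ?f = "\<lambda>t. r mod int m + int m * int t"
  have "{x \<in> {0..<int n}. int m dvd x - r} = ?f ` {..<c}"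
  proof (intro equalityI subsetI)
    fix x assume "x \<in> {x \<in> {0..<int n}. int m dvd x - r}"
    then have x: "0 \<le> x" "x < int n" "x mod int m = r mod int m" by (auto simp: mod_eq_dvd_iff)
    have "x div int m < int c"
    proof (rule ccontr)
      assume "\<not> x div int m < int c"
      then have "int c * int m \<le> x div int m * int m" by (intro mult_right_mono) auto
      also have "\<dots> \<le> x" using c x(1) by (simp add: div_times_less_eq_dividend minus_mod_eq_div_mult[symmetric])
      finally show False using x(2) c by (simp add: mult.commute)
    qed
    moreover have "0 \<le> x div int m" using x(1) c by (simp add: pos_imp_zdiv_nonneg_iff)
    moreover have "x = r mod int m + int m * (x div int m)"
      using x(3) mod_mult_div_eq[of x "int m"] by simp
    ultimately show "x \<in> ?f ` {..<c}"
      by (intro image_eqI[of _ _ "nat (x div int m)"]) auto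
  next
    fix x assume "x \<in> ?f ` {..<c}"
    then obtain t where t: "t < c" "x = ?f t" by blast
    have "r mod int m < int m" "0 \<le> r mod int m" using c by simp_all
    moreover have "int m * int t \<le> int m * (int c - 1)" using t(1) by (intro mult_left_mono) auto
    moreover have "int m dvd ?f t - r"
    proof -
      have "int m dvd r mod int m - r" by (simp add: mod_eq_dvd_iff[symmetric])
      then have "int m dvd (r mod int m - r) + int m * int t" by (intro dvd_add) auto
      then show ?thesis by (simp add: algebra_simps)
    qed
    ultimately show "x \<in> {x \<in> {0..<int n}. int m dvd x - r}"
      using t(2) c(1) by (auto simp: algebra_simps)
  qed
  moreover have "inj_on ?f {..<c}" using c by (auto simp: inj_on_def)
  ultimately show ?thesis using c by (simp add: card_image)
qed

text \<open>The generator is the least positive element, and division with remainder shows that it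
  divides all others. Closure under differences already yields 0, negatives and sums.\<close>

lemma int_subgroup_generator:
  fixes H :: "int set"
  assumes "\<And>x y. x \<in> H \<Longrightarrow> y \<in> H \<Longrightarrow> x - y \<in> H" "h \<in> H" "h \<noteq> 0"
  obtains e where "0 < e" "\<And>x. x \<in> H \<longleftrightarrow> e dvd x"
proof -
  have zero: "0 \<in> H" using assms(1)[OF assms(2,2)] by simp
  have minus: "- x \<in> H" if "x \<in> H" for x using assms(1)[OF zero that] by simp
  have add: "x + y \<in> H" if "x \<in> H" "y \<in> H" for x y using assms(1)[OF that(1) minus[OF that(2)]] by simp
  have mult_nat: "int t * x \<in> H" if "x \<in> H" for x t
    by (induction t) (use zero add that in \<open>auto simp: distrib_right\<close>)
  have mult: "t * x \<in> H" if "x \<in> H" for x t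
    using mult_nat[OF that, of "nat t"] minus[OF mult_nat[OF that, of "nat (- t)"]]
    by (cases "0 \<le> t") auto
  define e where "e = (LEAST t::nat. 0 < t \<and> int t \<in> H)"
  have "\<bar>h\<bar> \<in> H" using assms(2) minus by (simp add: abs_if)
  then have "0 < nat \<bar>h\<bar> \<and> int (nat \<bar>h\<bar>) \<in> H" using assms(3) by simp
  then have e: "0 < e \<and> int e \<in> H" unfolding e_def by (rule LeastI)
  have "x \<in> H \<longleftrightarrow> int e dvd x" for x
  proof
    assume x: "x \<in> H"
    have "x mod int e = x - x div int e * int e" by (simp add: minus_div_mult_eq_mod)
    then have "x mod int e \<in> H" using assms(1)[OF x mult] e by simp
    moreover have "0 \<le> x mod int e" "x mod int e < int e" using e by simp_all
    moreover from this have "nat (x mod int e) < e" by linarith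
    ultimately have "\<not> 0 < nat (x mod int e)"
      using not_less_Least[of "nat (x mod int e)" "\<lambda>t. 0 < t \<and> int t \<in> H"] unfolding e_def[symmetric]
      by auto
    then have "x mod int e = 0" using \<open>0 \<le> x mod int e\<close> by linarith
    then show "int e dvd x" by (rule mod_0_imp_dvd)
  next
    assume "int e dvd x"
    then obtain t where "x = int e * t" by blast
    then show "x \<in> H" using mult[of "int e" t] e by (simp add: mult.commute)
  qed
  with e show ?thesis by (intro that[of "int e"]) auto
qed

text \<open>The set \<open>{x. D True True (x + a)}\<close> is a subgroup \<open>e \<int>\<close> of \<open>\<int>\<close>. It contains \<open>2 * a\<close> but not \<open>a\<close>,
  so \<open>e = 2 * d\<close> is even and \<open>a\<close> is an odd multiple of \<open>d\<close>.\<close>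

lemma odd_multiples_structure:
  fixes D :: "bool \<Rightarrow> bool \<Rightarrow> int \<Rightarrow> bool"
  assumes sym: "\<And>b c x. D c b (- x) \<longleftrightarrow> D b c x"
    and irrefl: "\<not> D True True 0"
    and triple: "\<And>b c b' c' x y z. D b c x \<Longrightarrow> D c b' y \<Longrightarrow> D b' c' z \<Longrightarrow> D b c' (x + y + z)"
    and a: "D True True a" and b: "D False False b" and q: "D True False q"
  obtains d s where "0 < d" "\<And>b x. D b b x \<longleftrightarrow> 2 * d dvd x - d"
    "\<And>x. D True False x \<longleftrightarrow> 2 * d dvd x - s - d"
proof -
  let ?H = "{x. D True True (x + a)}"
  have a0: "a \<noteq> 0" using a irrefl by auto
  have ma: "D True True (- a)" using a sym by blast
  have mq: "D False True (- q)" using q sym by blast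
  \<comment> \<open>Closure under differences comes from \<open>(x + a) - (y + a) + a\<close>, a sum
    of three. The element \<open>- 2 * a\<close> is present because \<open>- a\<close> is a
    difference between positive vertices.\<close>
  have "\<exists>e>0. \<forall>x. x \<in> ?H \<longleftrightarrow> e dvd x"
  proof (rule int_subgroup_generator[of ?H "- 2 * a"])
    fix x y assume "x \<in> ?H" "y \<in> ?H"
    then have "D True True (x + a)" "D True True (- (y + a))" using sym by blast+
    from triple[OF this a] show "x - y \<in> ?H" by simp
  qed (use ma a0 in auto)
  then obtain e where e: "0 < e" "\<And>x. D True True (x + a) \<longleftrightarrow> e dvd x" by auto
  have "e dvd 2 * a" using e(2)[of "- 2 * a"] ma by simp
  then obtain m where m: "2 * a = e * m" by blast
  have nd: "\<not> e dvd a" using e(2)[of "- a"] irrefl by simp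
  have "odd m"
  proof
    assume "even m"
    then obtain t where "m = 2 * t" by blast
    then have "a = e * t" using m by simp
    then show False using nd by simp
  qed
  moreover have "even (e * m)" using m[symmetric] by simp
  ultimately have "even e" by simp
  then obtain d where d: "e = 2 * d" by blast
  from \<open>odd m\<close> obtain t where t: "m = 2 * t + 1" by (rule oddE)
  have "a = d * (2 * t + 1)" using m by (simp add: d t)
  then have "a - d = 2 * d * t" by (simp add: algebra_simps)
  then have ad: "2 * d dvd a - d" by simp
  have TT: "D True True x \<longleftrightarrow> 2 * d dvd x - d" for x
  proof -
    have "D True True x \<longleftrightarrow> 2 * d dvd x - a" using e(2)[of "x - a"] by (simp add: d)
    also have "\<dots> \<longleftrightarrow> 2 * d dvd (a - d) + (x - a)" using dvd_add_right_iff[OF ad] by blast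
    finally show ?thesis by simp
  qed
  \<comment> \<open>A step \<open>x\<close> between vertices of one sign, preceded by
    \<open>q\<close> or \<open>- q\<close> and followed by its opposite, becomes a step
    \<open>x\<close> between vertices of the other sign.\<close>
  have FF: "D False False x \<longleftrightarrow> D True True x" for x
    using triple[OF q _ mq, of x] triple[OF mq _ q, of x] by auto
  \<comment> \<open>The shift \<open>q - d\<close> is chosen so that \<open>q\<close> itself lies in
    the class. The steps \<open>- q\<close> and \<open>a\<close> turn a mixed difference
    \<open>x\<close> into \<open>x - q + a\<close>, a difference of equal signs, and
    \<open>- a\<close> and \<open>q\<close> lead back.\<close>
  have TF: "D True False x \<longleftrightarrow> 2 * d dvd x - (q - d) - d" for x
  proof
    assume "D True False x"
    from triple[OF this mq a] have "D True True (x - q + a)" by simp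
    then have "2 * d dvd (x - q + a - d) - (a - d)" using TT ad by (metis dvd_diff)
    then show "2 * d dvd x - (q - d) - d" by (simp add: algebra_simps)
  next
    assume "2 * d dvd x - (q - d) - d"
    then have "2 * d dvd (x - (q - d) - d) + (a - d)" using ad by (rule dvd_add)
    then have "D True True (x - q + a)" by (simp add: TT algebra_simps)
    from triple[OF this ma q] show "D True False x" by simp
  qed
  have "D b b x \<longleftrightarrow> 2 * d dvd x - d" for b x using TT FF by (cases b) auto
  moreover have "0 < d" using e(1) d by simp
  ultimately show ?thesis using TF by (intro that[of d "q - d"])
qed

section \<open>The multisets of subscript differences, indexed by positions of the word\<close>

lemma int_subscript_diff:
  assumes "i < n"
  shows "int (subscript_diff n i j) = (int j - int i) mod int n"
proof -
  have "int (subscript_diff n i j) = (int j + (int n - int i)) mod int n"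
    using assms by (simp add: subscript_diff_def of_nat_mod of_nat_diff algebra_simps)
  also have "int j + (int n - int i) = int j - int i + int n" by simp
  finally show ?thesis by simp
qed

lemma image_mset_set_cong:
  assumes "S = T" "\<And>p. p \<in> T \<Longrightarrow> f p = g p"
  shows "image_mset f (mset_set S) = image_mset g (mset_set T)"
  using assms by (cases "finite T") (auto intro!: image_mset_cong)

lemma cyclic_pairs_eq:
  "cyclic_pairs w = image_mset (\<lambda>p. (w ! p, w ! (Suc p mod length w))) (mset_set {..<length w})"
proof -
  have "zip w (rotate1 w) = map (\<lambda>p. (w ! p, w ! (Suc p mod length w))) [0..<length w]"
    by (rule nth_equalityI) (simp_all add: nth_rotate1)
  then show ?thesis
    by (simp add: cyclic_pairs_def mset_upt flip: atLeast0LessThan)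
qed

context cyclic_word
begin

text \<open>As an edge inverts the second letter, a change of sign away from \<open>b\<close> gives
  an edge between two vertices of the same sign \<open>b\<close>. These positions carry the entries
  of \<open>A_mset\<close> and \<open>B_mset\<close>.\<close>

definition turns :: "bool \<Rightarrow> nat set" where
  "turns b = {p. p < length w \<and> sgn p = b \<and> sgn (Suc p) = (\<not> b)}"

definition straights :: "nat set" where
  "straights = {p. p < length w \<and> sgn (Suc p) = sgn p}"

text \<open>At a straight position the edge joins vertices of opposite signs; the difference is
  taken from the positive to the negative one. This matches the convention of
  \<open>Qminus_mset\<close>, which shifts the first subscript.\<close>

definition odiff :: "nat \<Rightarrow> int" where
  "odiff p = (if sgn p then diff p else - diff p)"

lemma finite_turns [simp]: "finite (turns b)" and finite_straights [simp]: "finite straights"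
  by (simp_all add: turns_def straights_def)

lemma card_turns_straights: "card (turns True) + card (turns False) + card straights = length w"
proof -
  have "{..<length w} = turns True \<union> turns False \<union> straights"
    by (auto simp: turns_def straights_def)
  moreover have "card (turns True \<union> turns False \<union> straights) = card (turns True) + card (turns False) + card straights"
    by (subst card_Un_disjoint, simp, simp, force simp: turns_def straights_def)
       (subst card_Un_disjoint, auto simp: turns_def)
  ultimately show ?thesis by (metis card_lessThan)
qed

lemma sub_bounds: "0 \<le> sub p" "sub p < int n"
proof -
  have "w ! (p mod length w) \<in> set w" using length_pos by simp
  then show "0 \<le> sub p" "sub p < int n" using letters by (auto simp: sub_def)
qed

lemma nth_eq: "p < length w \<Longrightarrow> w ! p = (nat (sub p), sgn p)"
  by (simp add: sub_def sgn_def)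

lemma nth_Suc_eq: "w ! (Suc p mod length w) = (nat (sub (Suc p)), sgn (Suc p))"
  by (simp add: sub_def sgn_def)

lemma subscript_diff_nth:
  "subscript_diff n (nat (sub p)) (nat (sub (Suc p))) = nat (diff p mod int n)"
  "subscript_diff n (nat (sub (Suc p))) (nat (sub p)) = nat (- diff p mod int n)"
  using int_subscript_diff[of "nat (sub p)" n "nat (sub (Suc p))"] 
    int_subscript_diff[of "nat (sub (Suc p))" n "nat (sub p)"] sub_bounds
  by (simp_all add: diff_def nat_less_iff) 

lemma filtered_cyclic_pairs:
  "image_mset f (filter_mset P (cyclic_pairs w)) =
    image_mset (\<lambda>p. f (w ! p, w ! (Suc p mod length w)))
      (mset_set {p. p < length w \<and> P (w ! p, w ! (Suc p mod length w))})"
  unfolding cyclic_pairs_eq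
  by (simp add: filter_mset_image_mset filter_mset_mset_set multiset.map_comp comp_def)

lemma A_mset_eq: "A_mset n w = image_mset (\<lambda>p. nat (diff p mod int n)) (mset_set (turns True))"
  unfolding A_mset_def filtered_cyclic_pairs
  by (rule image_mset_set_cong) (auto simp: turns_def nth_Suc_eq nth_eq subscript_diff_nth)

lemma B_mset_eq: "B_mset n w = image_mset (\<lambda>p. nat (diff p mod int n)) (mset_set (turns False))"
  unfolding B_mset_def filtered_cyclic_pairs
  by (rule image_mset_set_cong) (auto simp: turns_def nth_Suc_eq nth_eq subscript_diff_nth)

lemma Qplus_mset_eq:
  "Qplus_mset n w = image_mset (\<lambda>p. nat (odiff p mod int n)) (mset_set {p \<in> straights. sgn p})"
  unfolding Qplus_mset_def filtered_cyclic_pairs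
  by (rule image_mset_set_cong) (auto simp: straights_def odiff_def nth_Suc_eq nth_eq subscript_diff_nth)

lemma Qminus_mset_eq:
  "Qminus_mset n w = image_mset (\<lambda>p. nat (odiff p mod int n)) (mset_set {p \<in> straights. \<not> sgn p})"
  unfolding Qminus_mset_def filtered_cyclic_pairs
  by (rule image_mset_set_cong) (auto simp: straights_def odiff_def nth_Suc_eq nth_eq subscript_diff_nth)

lemma Q_mset_eq: "Q_mset n w = image_mset (\<lambda>p. nat (odiff p mod int n)) (mset_set straights)"
proof -
  have "straights = {p \<in> straights. sgn p} \<union> {p \<in> straights. \<not> sgn p}" by blast
  then have "mset_set straights = mset_set {p \<in> straights. sgn p} + mset_set {p \<in> straights. \<not> sgn p}"
    using mset_set_Union[of "{p \<in> straights. sgn p}" "{p \<in> straights. \<not> sgn p}"] by force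
  then show ?thesis unfolding Q_mset_def Qplus_mset_eq Qminus_mset_eq by simp
qed

text \<open>Equal subscripts at a change of sign would be a cancelling pair of letters.\<close>

lemma not_dvd_diff_turn:
  assumes "p \<in> turns b"
  shows "\<not> int n dvd diff p"
proof
  assume "int n dvd diff p"
  then have "sub (Suc p) mod int n = sub p mod int n" by (simp add: diff_def mod_eq_dvd_iff)
  then have "sub (Suc p) = sub p" using sub_bounds by simp
  then have "w ! (Suc p mod length w) = inv_letter (w ! (p mod length w))"
    using assms nth_Suc_eq[of p] nth_eq[of p] by (auto simp: turns_def inv_letter_def)
  then show False using cyclically_reduced_nth[OF cyc_red, of p] length_pos by blast
qed

lemma ends_turn:
  assumes "p \<in> turns b"
  shows "src j p = vertex b (sub p + j)" "tgt j p = vertex b (sub p + diff p + j)"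
  using assms by (auto simp: turns_def src_def tgt_def diff_def)

lemma ends_straight:
  assumes "p \<in> straights"
  shows "{src j p, tgt j p} =
    (if sgn p then {vertex True (sub p + j), vertex False (sub p + j + odiff p)}
     else {vertex True (sub p + j - odiff p), vertex False (sub p + j)})"
  using assms by (auto simp: straights_def src_def tgt_def odiff_def diff_def algebra_simps)

text \<open>Edges at straight positions have ends of different signs, so two of them can coincide in
  only one way. Edges at turns may also coincide with source and target exchanged, which accounts
  for the condition on sums; for \<open>p = p'\<close> it forbids \<open>n\<close> to divide
  \<open>2 * diff p\<close>.\<close>

lemma simple_iff:
  "simple \<longleftrightarrow>
    (\<forall>b. \<forall>p\<in>turns b. \<forall>p'\<in>turns b. (int n dvd diff p - diff p' \<longrightarrow> p = p') \<and> \<not> int n dvd diff p + diff p') \<and>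
    (\<forall>p\<in>straights. \<forall>p'\<in>straights. int n dvd odiff p - odiff p' \<longrightarrow> p = p')" (is "_ \<longleftrightarrow> ?turns \<and> ?straights")
proof
  assume simple: simple
  have ?turns
  proof (intro allI ballI conjI impI notI)
    fix b p p' assume p: "p \<in> turns b" "p' \<in> turns b"
    then have lt: "p < length w" "p' < length w" by (auto simp: turns_def)
    {
      assume "int n dvd diff p - diff p'"
      \<comment> \<open>The shift \<open>- sub p\<close> puts the source at subscript 0, so both
        edges run from there to the same vertex.\<close>
      then have "{src (- sub p) p, tgt (- sub p) p} = {src (- sub p') p', tgt (- sub p') p'}"
        using p by (simp add: ends_turn vertex_mod_eq)
      from simpleD(1)[OF simple this lt] show "p = p'" .
    next
      assume *: "int n dvd diff p + diff p'"
      then have "vertex b (- diff p') = vertex b (diff p)"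
        by (intro vertex_mod_eq) (metis add.commute diff_minus_eq_add dvd_minus_iff minus_add_distrib uminus_add_conv_diff)
      \<comment> \<open>Shifted by a further \<open>- diff p'\<close>, the second edge has its
        target at subscript 0 and is the first one read backwards. Simplicity then gives
        \<open>p = p'\<close> and congruent shifts, although these differ by
        \<open>diff p\<close>.\<close>
      then have "{src (- sub p) p, tgt (- sub p) p} = {src (- sub p' - diff p') p', tgt (- sub p' - diff p') p'}"
        using p by (simp add: ends_turn insert_commute)
      from simpleD[OF simple this lt] have "p = p'" "int n dvd - sub p - (- sub p' - diff p')" by auto
      then have "int n dvd diff p" by simp
      then show False using not_dvd_diff_turn p by blast
    }
  qed
  moreover have ?straights
  proof (intro ballI impI)
    fix p p' assume p: "p \<in> straights" "p' \<in> straights" and *: "int n dvd odiff p - odiff p'"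
    then have lt: "p < length w" "p' < length w" by (auto simp: straights_def)
    \<comment> \<open>The shift that puts the positive end of the edge at subscript 0.\<close>
    define j where "j p = (if sgn p then - sub p else odiff p - sub p)" for p
    have "{src (j p) p, tgt (j p) p} = {vertex True 0, vertex False (odiff p)}" if "p \<in> straights" for p
      using ends_straight[OF that] by (simp add: j_def)
    then have "{src (j p) p, tgt (j p) p} = {src (j p') p', tgt (j p') p'}"
      using p vertex_mod_eq[OF *] by simp
    from simpleD(1)[OF simple this lt] show "p = p'" .
  qed
  ultimately show "?turns \<and> ?straights" ..
next
  assume "?turns \<and> ?straights"
  then have rules: ?turns ?straights by blast+
  have T: "p = p'" if "p \<in> turns b" "p' \<in> turns b" "int n dvd diff p - diff p'" for b p p'
    using rules(1) that by blast
  have T': "\<not> int n dvd diff p + diff p'" if "p \<in> turns b" "p' \<in> turns b" for b p p'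
    using rules(1) that by blast
  have S: "p = p'" if "p \<in> straights" "p' \<in> straights" "int n dvd odiff p - odiff p'" for p p'
    using rules(2) that by blast
  show simple
    unfolding simple_def
  proof (intro allI impI)
    fix j j' p p'
    assume p: "p < length w" "p' < length w" and eq: "{src j p, tgt j p} = {src j' p', tgt j' p'}"
    from eq consider "src j p = src j' p'" "tgt j p = tgt j' p'" | "src j p = tgt j' p'" "tgt j p = src j' p'"
      by (auto simp: doubleton_eq_iff)
    then show "p = p' \<and> int n dvd j - j'"
    proof cases
      case 1
      then have s: "sgn p = sgn p'" "sgn (Suc p) = sgn (Suc p')"
        and d: "int n dvd (sub p + j) - (sub p' + j')" "int n dvd (sub (Suc p) + j) - (sub (Suc p') + j')"
        by (auto simp: src_def tgt_def vertex_eq_iff)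
      have dd: "int n dvd diff p - diff p'" using dvd_diff[OF d(2,1)] by (simp add: diff_def algebra_simps)
      have "p = p'"
      proof (cases "sgn (Suc p) = sgn p")
        case True
        then have "p \<in> straights" "p' \<in> straights" using s p by (auto simp: straights_def)
        moreover have "int n dvd odiff p - odiff p'"
          using dd s(1) dvd_diff_commute[of "int n" "diff p'" "diff p"] by (simp add: odiff_def)
        ultimately show ?thesis by (rule S)
      next
        case False
        then have "p \<in> turns (sgn p)" "p' \<in> turns (sgn p)" using s p by (auto simp: turns_def)
        then show ?thesis using dd by (rule T)
      qed
      with d(1) show ?thesis by simp
    next
      case 2
      then have s: "sgn p = (\<not> sgn (Suc p'))" "sgn (Suc p) = (\<not> sgn p')"
        and d: "int n dvd (sub p + j) - (sub (Suc p') + j')" "int n dvd (sub (Suc p) + j) - (sub p' + j')"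
        by (auto simp: src_def tgt_def vertex_eq_iff)
      have dd: "int n dvd diff p + diff p'" using dvd_diff[OF d(2,1)] by (simp add: diff_def algebra_simps)
      show ?thesis
      proof (cases "sgn (Suc p) = sgn p")
        case True
        then have "p \<in> straights" "p' \<in> straights" using s p by (auto simp: straights_def)
        moreover have "int n dvd odiff p - odiff p'"
        proof -
          have "- diff p - diff p' = - (diff p + diff p')" by simp
          then have "int n dvd - diff p - diff p'" using dd by (metis dvd_minus_iff)
          then show ?thesis using dd s True by (auto simp: odiff_def)
        qed
        \<comment> \<open>Here \<open>p\<close> and \<open>p'\<close> have opposite signs, so their
          coincidence is absurd.\<close>
        ultimately have "p = p'" by (rule S)
        then show ?thesis using s True by simp
      next
        case False
        then have "p \<in> turns (sgn p)" "p' \<in> turns (sgn p)" using s p by (auto simp: turns_def)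
        then show ?thesis using dd T' by blast
      qed
    qed
  qed
qed

lemma joined_same_iff:
  "joined b b x \<longleftrightarrow> (\<exists>p\<in>turns b. int n dvd x - diff p \<or> int n dvd x + diff p)"
  by (auto simp: joined_def turns_def)

lemma joined_True_False_iff:
  "joined True False x \<longleftrightarrow> (\<exists>p\<in>straights. int n dvd x - odiff p)"
  by (auto simp: joined_def straights_def odiff_def)

text \<open>A turn accounts for \<open>diff p\<close> and its negative, according to the direction
  of reading. Simplicity keeps all of these apart modulo \<open>n\<close>, including the two of a
  single turn.\<close>

lemma card_joined_same:
  assumes simple
  shows "card {x \<in> {0..<int n}. joined b b x} = 2 * card (turns b)"
proof -
  let ?f = "\<lambda>(p, c). (if c then diff p else - diff p) mod int n"
  have T: "p = p'" if "p \<in> turns b" "p' \<in> turns b" "int n dvd diff p - diff p'" for p p'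
    using assms that unfolding simple_iff by blast
  have T': "\<not> int n dvd diff p + diff p'" if "p \<in> turns b" "p' \<in> turns b" for p p'
    using assms that unfolding simple_iff by blast
  have "inj_on ?f (turns b \<times> UNIV)"
  proof (rule inj_onI, clarify)
    fix p c p' c'
    assume p: "p \<in> turns b" "p' \<in> turns b"
      and "(if c then diff p else - diff p) mod int n = (if c' then diff p' else - diff p') mod int n"
    then have d: "int n dvd (if c then diff p else - diff p) - (if c' then diff p' else - diff p')"
      by (simp add: mod_eq_dvd_iff)
    then have "c = c'"
      using T'[OF p] dvd_minus_iff[of "int n" "diff p + diff p'"] by (auto split: if_splits)
    moreover have "p = p'"
      using d T[OF p] \<open>c = c'\<close> dvd_diff_commute[of "int n" "diff p'" "diff p"] by (auto split: if_splits)
    ultimately show "p = p' \<and> c = c'" by simp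
  qed
  then have "card (?f ` (turns b \<times> UNIV)) = 2 * card (turns b)"
    by (simp only: card_image card_cartesian_product) simp
  moreover have "?f ` (turns b \<times> UNIV) = {x \<in> {0..<int n}. joined b b x}"
  proof (intro equalityI subsetI)
    fix x assume "x \<in> ?f ` (turns b \<times> UNIV)"
    then obtain p c where pc: "p \<in> turns b" "x = (if c then diff p else - diff p) mod int n" by auto
    then have "int n dvd x - (if c then diff p else - diff p)" by (simp add: mod_eq_dvd_iff[symmetric])
    then have "int n dvd x - diff p \<or> int n dvd x + diff p" by (cases c) auto
    moreover have "0 \<le> x" "x < int n" using pc n_pos by simp_all
    ultimately show "x \<in> {x \<in> {0..<int n}. joined b b x}" using pc joined_same_iff by auto
  next
    fix x assume "x \<in> {x \<in> {0..<int n}. joined b b x}"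
    then obtain p where p: "0 \<le> x" "x < int n" "p \<in> turns b" "int n dvd x - diff p \<or> int n dvd x - (- diff p)"
      using joined_same_iff by auto
    then have "x = diff p mod int n \<or> x = - diff p mod int n"
      by (metis mod_eq_dvd_iff mod_pos_pos_trivial)
    then have "x = ?f (p, True) \<or> x = ?f (p, False)" by simp
    with p(3) show "x \<in> ?f ` (turns b \<times> UNIV)" by blast
  qed
  ultimately show ?thesis by (simp only:)
qed

lemma joined_True_False_image:
  "{x \<in> {0..<int n}. joined True False x} = (\<lambda>p. odiff p mod int n) ` straights"
proof (intro equalityI subsetI)
  fix x assume "x \<in> {x \<in> {0..<int n}. joined True False x}"
  then obtain p where p: "0 \<le> x" "x < int n" "p \<in> straights" "int n dvd x - odiff p"
    using joined_True_False_iff by auto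
  then have "x = odiff p mod int n" by (metis mod_eq_dvd_iff mod_pos_pos_trivial)
  with p(3) show "x \<in> (\<lambda>p. odiff p mod int n) ` straights" by blast
next
  fix x assume "x \<in> (\<lambda>p. odiff p mod int n) ` straights"
  then obtain p where p: "p \<in> straights" "x = odiff p mod int n" by blast
  then have "int n dvd x - odiff p" by (simp add: mod_eq_dvd_iff[symmetric])
  moreover have "0 \<le> x" "x < int n" using p n_pos by simp_all
  ultimately show "x \<in> {x \<in> {0..<int n}. joined True False x}"
    using p joined_True_False_iff by auto
qed

text \<open>A straight position accounts for one difference only, the direction from positive to
  negative being prescribed.\<close>

lemma card_joined_True_False:
  assumes simple
  shows "card {x \<in> {0..<int n}. joined True False x} = card straights"
proof -
  have "inj_on (\<lambda>p. odiff p mod int n) straights"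
    using assms unfolding simple_iff by (auto simp: inj_on_def mod_eq_dvd_iff)
  then show ?thesis unfolding joined_True_False_image by (rule card_image)
qed

end

section \<open>The characterization\<close>

lemma odd_multiple_cases:
  assumes "0 \<le> x" "x < int (d * k)" "2 * int d dvd x - int d" "0 < d"
  obtains j where "x = int (j * d)" "odd j" "j \<le> k - 1"
proof -
  from assms(3) obtain t where t: "x - int d = 2 * int d * t" by blast
  then have x: "x = int d * (2 * t + 1)" by (simp add: algebra_simps)
  then have "0 \<le> 2 * t + 1" using assms(1,4) by (simp add: zero_le_mult_iff)
  then obtain u where u: "t = int u" using nonneg_int_cases[of t] by auto
  have x': "x = int ((2 * u + 1) * d)" using x u by (simp add: algebra_simps)
  then have "(2 * u + 1) * d < k * d" using assms(2) by (simp only: of_nat_less_iff mult.commute)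
  then have "2 * u + 1 < k" by (simp only: mult_less_cancel2)
  then show ?thesis using x' by (intro that[of "2 * u + 1"]) auto
qed

lemma card_odd_le:
  assumes "even k"
  shows "card {j. odd j \<and> j \<le> k - 1} = k div 2"
proof -
  have "{j. odd j \<and> j \<le> k - 1} = (\<lambda>i. 2 * i + 1) ` {..<k div 2}"
  proof (intro equalityI subsetI)
    fix j assume "j \<in> {j. odd j \<and> j \<le> k - 1}"
    then obtain i where "j = 2 * i + 1" "j \<le> k - 1" by (auto elim: oddE)
    then show "j \<in> (\<lambda>i. 2 * i + 1) ` {..<k div 2}" using assms by (auto elim!: evenE)
  next
    fix j assume "j \<in> (\<lambda>i. 2 * i + 1) ` {..<k div 2}"
    then obtain i where i: "j = 2 * i + 1" "i < k div 2" by blast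
    moreover have "j \<le> k - 1" using i by linarith
    ultimately show "j \<in> {j. odd j \<and> j \<le> k - 1}" by simp
  qed
  then show ?thesis by (simp add: card_image inj_on_def)
qed

text \<open>Translates between the congruence used in the proof and the explicit list in the
  statement. Reduction modulo \<open>n\<close> respects the congruence because \<open>2 * d\<close>
  divides \<open>n\<close>, \<open>k\<close> being even.\<close>

lemma residue_class_eq_image:
  assumes n: "n = d * k" and k: "even k" "0 < k" and d: "0 < d"
  shows "nat ` {x \<in> {0..<int n}. 2 * int d dvd x - int s - int d} =
    (\<lambda>j. (s + j * d) mod n) ` {j. odd j \<and> j \<le> k - 1}"
proof (intro equalityI subsetI)
  have dn: "2 * int d dvd int n" using k(1) by (auto simp: n elim!: evenE)
  fix y assume "y \<in> nat ` {x \<in> {0..<int n}. 2 * int d dvd x - int s - int d}"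
  then obtain x where x: "y = nat x" "0 \<le> x" "x < int n" "2 * int d dvd x - int s - int d" by auto
  define z where "z = (x - int s) mod int n"
  have z: "0 \<le> z" "z < int (d * k)" using x n by (auto simp: z_def)
  have zx: "int n dvd z - (x - int s)" by (simp add: z_def mod_eq_dvd_iff[symmetric])
  then have "2 * int d dvd (z - (x - int s)) + (x - int s - int d)"
    using dn x(4) by (meson dvd_add dvd_trans)
  then have "2 * int d dvd z - int d" by simp
  from odd_multiple_cases[OF z this d] obtain j where j: "z = int (j * d)" "odd j" "j \<le> k - 1" .
  have "(int s + z) mod int n = x mod int n"
    using zx by (simp add: mod_eq_dvd_iff algebra_simps)
  then have "int ((s + j * d) mod n) = x" using x j by (simp add: of_nat_mod)
  then have "y = (s + j * d) mod n" using x(1) by simp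
  with j show "y \<in> (\<lambda>j. (s + j * d) mod n) ` {j. odd j \<and> j \<le> k - 1}" by blast
next
  have dn: "2 * int d dvd int n" using k(1) by (auto simp: n elim!: evenE)
  fix y assume "y \<in> (\<lambda>j. (s + j * d) mod n) ` {j. odd j \<and> j \<le> k - 1}"
  then obtain j where j: "y = (s + j * d) mod n" "odd j" by blast
  have "0 < n" using n d k by simp
  have "int n dvd int y - (int s + int j * int d)"
    by (simp add: j(1) of_nat_mod mod_eq_dvd_iff[symmetric])
  then have "2 * int d dvd int y - (int s + int j * int d)" using dn dvd_trans by blast
  moreover have "2 * int d dvd int j * int d - int d"
    using j(2) by (auto elim!: oddE simp: algebra_simps)
  ultimately have "2 * int d dvd (int y - (int s + int j * int d)) + (int j * int d - int d)"
    by (rule dvd_add)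
  then have "2 * int d dvd int y - int s - int d" by (simp add: algebra_simps)
  then show "y \<in> nat ` {x \<in> {0..<int n}. 2 * int d dvd x - int s - int d}"
    using \<open>0 < n\<close> j(1) by (intro image_eqI[of _ _ "int y"]) auto
qed

lemma inj_on_shifted_odd_multiples:
  fixes n d k s :: nat
  assumes n: "n = d * k" "0 < k" "0 < d"
  shows "inj_on (\<lambda>j. (s + j * d) mod n) {j. odd j \<and> j \<le> k - 1}"
proof (rule inj_onI)
  fix i j assume ij: "i \<in> {j. odd j \<and> j \<le> k - 1}" "j \<in> {j. odd j \<and> j \<le> k - 1}"
    and eq: "(s + i * d) mod n = (s + j * d) mod n"
  have "int (s + i * d) mod int n = int (s + j * d) mod int n" using arg_cong[OF eq, of int] by (simp only: of_nat_mod)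
  then have "int n dvd int (s + i * d) - int (s + j * d)" by (simp add: mod_eq_dvd_iff)
  then have "int d * int k dvd int d * (int i - int j)" by (simp add: n(1) algebra_simps)
  then have "int k dvd int i - int j" using n(3) by simp
  then have "int i mod int k = int j mod int k" by (simp add: mod_eq_dvd_iff)
  moreover have "i < k" "j < k" using ij n(2) by auto
  ultimately show "i = j" by simp
qed

context cyclic_word
begin

text \<open>The normal form of adjacency; \<open>d\<close> turns out to be \<nu>. The summand
  \<open>d\<close> in the second clause makes the mixed differences \<open>s\<close> plus odd
  multiples of \<open>d\<close>, as the statement lists them.\<close>

definition structured :: "nat \<Rightarrow> int \<Rightarrow> bool" where
  "structured d s \<longleftrightarrow> (\<forall>b x. joined b b x \<longleftrightarrow> 2 * int d dvd x - int d) \<and>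
    (\<forall>x. joined True False x \<longleftrightarrow> 2 * int d dvd x - s - int d)"

lemma structuredD:
  assumes "structured d s"
  shows "joined b b x \<longleftrightarrow> 2 * int d dvd x - int d"
    "joined True False x \<longleftrightarrow> 2 * int d dvd x - s - int d"
  using assms by (simp_all add: structured_def)

text \<open>Adjacency does not see multiples of \<open>n\<close>, so \<open>d\<close> and
  \<open>d + n\<close> lie in the same class modulo \<open>2 * d\<close>.\<close>

lemma structured_dvd:
  assumes "structured d s"
  shows "2 * d dvd n"
proof -
  have "joined True True (int d)" using structuredD(1)[OF assms] by simp
  then have "joined True True (int d + int n)" using joined_cong[of "int d + int n" "int d"] by simp
  then have "2 * int d dvd int n" using structuredD(1)[OF assms] by simp
  then show ?thesis by (metis of_nat_dvd_iff of_nat_mult of_nat_numeral)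
qed

text \<open>Each of the three sets of differences is one residue class modulo \<open>2 * d\<close>,
  with \<open>c\<close> members where \<open>n = 2 * d * c\<close>. Turns of either sign count twice
  and straights once, so the word has \<open>c / 2 + c / 2 + c\<close> positions.\<close>

lemma structured_counts:
  assumes "simple" "structured d s" "0 < d"
  shows "n = d * length w" "4 dvd length w" "card (turns b) = length w div 4"
proof -
  obtain c where c: "n = 2 * d * c" using structured_dvd[OF assms(2)] by blast
  have "card {x \<in> {0..<int n}. int (2 * d) dvd x - r} = c" for r
    using card_residue_class[OF structured_dvd[OF assms(2)] n_pos] c assms(3) by simp
  note cc = this[of "int d"] this[of "s + int d"]
  have t: "2 * card (turns b) = c" for b
    using card_joined_same[OF assms(1), of b] cc(1) structuredD(1)[OF assms(2)] by simp
  have "card straights = c"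
    using card_joined_True_False[OF assms(1)] cc(2) structuredD(2)[OF assms(2)]
    by (simp add: algebra_simps)
  then have l: "length w = 4 * card (turns b)" for b
    using card_turns_straights t[of True] t[of False] t[of b] by linarith
  show "4 dvd length w" using l[of True] by simp
  show "card (turns b) = length w div 4" using l[of b] by simp
  show "n = d * length w" using c t[of True] l[of True] by simp
qed

lemma sgn_mod: "sgn (p mod length w) = sgn p" "sgn (Suc (p mod length w)) = sgn (Suc p)"
  and sub_mod: "sub (p mod length w) = sub p" "sub (Suc (p mod length w)) = sub (Suc p)"
  by (simp_all add: sgn_def sub_def mod_Suc_eq)

text \<open>Without a change away from \<open>b\<close> the sign would stay \<open>b\<close> all the
  way round.\<close>

lemma turns_nonempty:
  assumes "sgn p = b" "sgn q = (\<not> b)"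
  shows "turns b \<noteq> {}"
proof
  assume empty: "turns b = {}"
  have step: "sgn (Suc r) = b" if "sgn r = b" for r
  proof -
    have "r mod length w \<notin> turns b" using empty by simp
    then show ?thesis using that sgn_mod length_pos by (auto simp: turns_def)
  qed
  have all: "sgn (p + m) = b" for m by (induction m) (use assms step in auto)
  \<comment> \<open>Enough full rounds are added to \<open>q\<close> to bring it past
    \<open>p\<close> without changing its letter.\<close>
  have "p \<le> q + p * length w" using length_pos by (cases "length w") auto
  then have "sgn (q + p * length w) = b" using all[of "q + p * length w - p"] by simp
  then show False using assms(2) by (simp add: sgn_def)
qed

lemma straights_nonempty:
  assumes "\<not> alternating_word w"
  shows "straights \<noteq> {}"
proof
  assume "straights = {}"
  then have "snd (w ! p) \<noteq> snd (w ! (Suc p mod length w))" if "p < length w" for p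
    using that by (auto simp: straights_def sgn_def)
  then have "alternating_word w" by (auto simp: alternating_word_def cyclic_pairs_eq)
  then show False using assms by simp
qed

text \<open>The differences telescope, starting from a position with subscript 0.\<close>

lemma all_sub_dvd:
  assumes "sub p0 = 0" "\<And>p. p < length w \<Longrightarrow> g dvd diff p"
  shows "g dvd sub p"
proof -
  have step: "g dvd sub (Suc r) - sub r" for r
    using assms(2)[of "r mod length w"] length_pos by (simp add: diff_def sub_mod)
  have all: "g dvd sub (p0 + m)" for m
  proof (induction m)
    case (Suc m)
    then have "g dvd (sub (Suc (p0 + m)) - sub (p0 + m)) + sub (p0 + m)"
      using step by (intro dvd_add) auto
    then show ?case by simp
  qed (use assms in simp)
  have "p0 \<le> p + p0 * length w" using length_pos by (cases "length w") auto
  then have "g dvd sub (p + p0 * length w)" using all[of "p + p0 * length w - p0"] by simp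
  then show ?thesis by (simp add: sub_def)
qed

lemma joined_diff: "p \<in> turns b \<Longrightarrow> joined b b (diff p)"
  and joined_odiff: "p \<in> straights \<Longrightarrow> joined True False (odiff p)"
  by (force simp: joined_same_iff joined_True_False_iff)+

lemma turn_value:
  assumes "simple" "structured d s" "0 < d" "p \<in> turns b"
  shows "\<exists>j. nat (diff p mod int n) = j * d \<and> odd j \<and> j \<le> length w - 1"
proof -
  have nx: "int n dvd diff p mod int n - diff p" by (simp add: mod_eq_dvd_iff[symmetric])
  have "joined b b (diff p mod int n)"
    using joined_diff[OF assms(4)] joined_cong[OF nx] by blast
  then have dv: "2 * int d dvd diff p mod int n - int d" using structuredD(1)[OF assms(2)] by blast
  have b: "0 \<le> diff p mod int n" "diff p mod int n < int (d * length w)"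
    using n_pos structured_counts(1)[OF assms(1-3)] by (simp_all del: of_nat_mult)
  from odd_multiple_cases[OF b dv assms(3)] show ?thesis by (metis nat_int)
qed

lemma Q_mset_structured:
  assumes "simple" "structured d (int s)" "0 < d"
  shows "Q_mset n w = image_mset (\<lambda>j. (s + j * d) mod n) (mset_set {j. odd j \<and> j \<le> length w - 1})"
proof -
  note n = structured_counts(1)[OF assms]
  have ev: "even (length w)" using structured_counts(2)[OF assms] by (meson dvd_trans dvd_triv_left even_numeral)
  have inj: "inj_on (\<lambda>p. nat (odiff p mod int n)) straights"
    using assms(1) n_pos unfolding simple_iff
    by (auto simp: inj_on_def eq_nat_nat_iff mod_eq_dvd_iff)
  have "Q_mset n w = mset_set ((\<lambda>p. nat (odiff p mod int n)) ` straights)"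
    unfolding Q_mset_eq by (rule image_mset_mset_set[OF inj])
  also have "(\<lambda>p. nat (odiff p mod int n)) ` straights = nat ` {x \<in> {0..<int n}. joined True False x}"
    unfolding joined_True_False_image by (simp add: image_image)
  also have "\<dots> = (\<lambda>j. (s + j * d) mod n) ` {j. odd j \<and> j \<le> length w - 1}"
    unfolding structuredD(2)[OF assms(2)]
    by (rule residue_class_eq_image[OF n ev length_pos assms(3)])
  also have "mset_set \<dots> = image_mset (\<lambda>j. (s + j * d) mod n) (mset_set {j. odd j \<and> j \<le> length w - 1})"
    by (rule image_mset_mset_set[symmetric, OF inj_on_shifted_odd_multiples[OF n length_pos assms(3)]])
  finally show ?thesis .
qed

text \<open>A common entry would come from a single straight position, which cannot have both
  signs.\<close>

lemma Qplus_Qminus_disjoint: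
  assumes simple
  shows "Qplus_mset n w \<inter># Qminus_mset n w = {#}"
proof -
  have "x \<noteq> y" if "x \<in># Qplus_mset n w" "y \<in># Qminus_mset n w" for x y
  proof
    assume "x = y"
    with that obtain p p' where p: "p \<in> straights" "sgn p" "p' \<in> straights" "\<not> sgn p'"
      "nat (odiff p mod int n) = nat (odiff p' mod int n)"
      by (auto simp: Qplus_mset_eq Qminus_mset_eq)
    then have "int n dvd odiff p - odiff p'" using n_pos by (simp add: eq_nat_nat_iff mod_eq_dvd_iff)
    then have "p = p'" using assms p unfolding simple_iff by blast
    then show False using p by simp
  qed
  then have "set_mset (Qplus_mset n w) \<inter> set_mset (Qminus_mset n w) = {}" by blast
  then show ?thesis by (metis set_mset_inter set_mset_eq_empty_iff)
qed

text \<open>One name for \<open>A_mset\<close> and \<open>B_mset\<close>, so that each argument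
  about them is given once for both signs.\<close>

definition turn_mset :: "bool \<Rightarrow> nat multiset" where
  "turn_mset b = image_mset (\<lambda>p. nat (diff p mod int n)) (mset_set (turns b))"

lemma turn_mset_eq: "A_mset n w = turn_mset True" "B_mset n w = turn_mset False"
  by (simp_all add: turn_mset_def A_mset_eq B_mset_eq)

text \<open>The residue of a turn lies strictly between 0 and \<open>n\<close>, so the truncated
  subtraction is exact, and two residues whose sum is divisible by \<open>n\<close> add up to
  \<open>n\<close> itself.\<close>

lemma complement_value_iff:
  assumes "p \<in> turns b"
  shows "n - nat (diff p mod int n) = nat (diff p' mod int n) \<longleftrightarrow> int n dvd diff p + diff p'"
proof -
  let ?x = "diff p mod int n" and ?y = "diff p' mod int n"
  have x: "0 < ?x" "?x < int n"
  proof -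
    have "?x \<noteq> 0" using not_dvd_diff_turn[OF assms] by (simp add: mod_eq_0_iff_dvd)
    moreover have "0 \<le> ?x" using n_pos by simp
    ultimately show "0 < ?x" by linarith
    show "?x < int n" using n_pos by simp
  qed
  have y: "0 \<le> ?y" "?y < int n" using n_pos by simp_all
  have "int n dvd diff p + diff p' \<longleftrightarrow> int n dvd ?x + ?y"
    by (metis dvd_eq_mod_eq_0 mod_add_eq)
  also have "\<dots> \<longleftrightarrow> ?x + ?y = int n"
  proof
    assume "int n dvd ?x + ?y"
    then obtain c where c: "?x + ?y = int n * c" by blast
    have "0 < int n * c" "int n * c < int n * 2" using x y c by linarith+
    then have "c = 1" using n_pos by (simp add: zero_less_mult_iff)
    then show "?x + ?y = int n" using c by simp
  qed simp
  also have "\<dots> \<longleftrightarrow> n - nat ?x = nat ?y" using x y by linarith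
  finally show ?thesis by simp
qed

text \<open>Repeated entries are parallel edges with matching directions, complementary ones
  parallel edges with opposite directions. The latter concern turns, whose edges can be read either
  way.\<close>

lemma simple_iff_msets:
  "simple \<longleftrightarrow>
    (\<forall>b. (\<forall>a. count (turn_mset b) a \<le> 1) \<and> (\<forall>a. a \<in># turn_mset b \<longrightarrow> n - a \<notin># turn_mset b)) \<and>
    (\<forall>q. count (Q_mset n w) q \<le> 1)"
proof -
  have eq: "nat (x mod int n) = nat (y mod int n) \<longleftrightarrow> int n dvd x - y" for x y
    using n_pos by (simp add: eq_nat_nat_iff mod_eq_dvd_iff)
  have "(\<forall>a. a \<in># turn_mset b \<longrightarrow> n - a \<notin># turn_mset b) \<longleftrightarrow>
    (\<forall>p\<in>turns b. \<forall>p'\<in>turns b. n - nat (diff p mod int n) \<noteq> nat (diff p' mod int n))" for b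
    by (auto simp: turn_mset_def)
  then have "(\<forall>a. a \<in># turn_mset b \<longrightarrow> n - a \<notin># turn_mset b) \<longleftrightarrow>
    (\<forall>p\<in>turns b. \<forall>p'\<in>turns b. \<not> int n dvd diff p + diff p')" for b
    by (simp add: complement_value_iff cong: ball_cong)
  moreover have "(\<forall>a. count (turn_mset b) a \<le> 1) \<longleftrightarrow>
    (\<forall>p\<in>turns b. \<forall>p'\<in>turns b. int n dvd diff p - diff p' \<longrightarrow> p = p')" for b
    unfolding turn_mset_def count_image_mset_set_le_1_iff[OF finite_turns] inj_on_def eq ..
  moreover have "(\<forall>q. count (Q_mset n w) q \<le> 1) \<longleftrightarrow>
    (\<forall>p\<in>straights. \<forall>p'\<in>straights. int n dvd odiff p - odiff p' \<longrightarrow> p = p')"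
    unfolding Q_mset_eq count_image_mset_set_le_1_iff[OF finite_straights] inj_on_def eq ..
  ultimately show ?thesis unfolding simple_iff by blast
qed

text \<open>A common divisor of \<open>s\<close> and \<open>d\<close> divides every difference of
  neighbouring subscripts and hence, starting from the letter with subscript 0, every subscript. It
  also divides \<open>n\<close>, a multiple of \<open>d\<close>, so irreducibility leaves only
  1.\<close>

lemma gcd_shift:
  assumes "simple" "structured d (int s)" "0 < d" "irreducible_cyclic n w" "0 \<in> fst ` set w"
  shows "gcd s d = 1"
proof -
  define g where "g = gcd s d"
  have gs: "int g dvd int s" "int g dvd int d" by (simp_all add: g_def)
  have d2: "int g dvd y" if "2 * int d dvd y" for y
    using that gs(2) by (meson dvd_mult2 dvd_mult dvd_trans)
  have "int g dvd diff p" if p: "p < length w" for p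
  proof (cases "p \<in> straights")
    case True
    have "2 * int d dvd odiff p - int s - int d"
      using joined_odiff[OF True] structuredD(2)[OF assms(2)] by blast
    from dvd_add[OF d2[OF this] dvd_add[OF gs]] have "int g dvd odiff p" by simp
    then show ?thesis by (simp add: odiff_def split: if_splits)
  next
    case False
    then have "p \<in> turns (sgn p)" using p by (auto simp: turns_def straights_def)
    then have "2 * int d dvd diff p - int d"
      using joined_diff structuredD(1)[OF assms(2)] by blast
    from dvd_add[OF d2[OF this] gs(2)] show ?thesis by simp
  qed
  moreover obtain p0 where "p0 < length w" "fst (w ! p0) = 0"
    using assms(5) by (force simp: in_set_conv_nth)
  then have "sub p0 = 0" by (simp add: sub_def)
  ultimately have sub: "int g dvd sub p" for p using all_sub_dvd by blast
  have "g dvd x" if "x \<in> insert n (fst ` set w)" for x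
    using that
  proof
    assume "x = n"
    then show ?thesis using structured_counts(1)[OF assms(1-3)] by (simp add: g_def)
  next
    assume "x \<in> fst ` set w"
    then obtain p where "p < length w" "x = fst (w ! p)" by (force simp: in_set_conv_nth)
    then have "int x = sub p" by (simp add: sub_def)
    then have "int g dvd int x" using sub[of p] by simp
    then show ?thesis by (simp only: of_nat_dvd_iff)
  qed
  then have "g dvd Gcd (insert n (fst ` set w))" by (rule Gcd_greatest)
  then have "g dvd 1" using assms(4) unfolding irreducible_cyclic_def by (simp only:)
  then show ?thesis by (simp add: g_def)
qed

text \<open>The hypotheses place the differences of equal signs inside one residue class modulo
  \<open>2 * d\<close>, and simplicity makes them as numerous as that class, so they exhaust it. The
  mixed differences are listed in full by the condition on \<open>Q_mset\<close>.\<close>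

lemma structured_if_conditions:
  assumes n: "n = d * k" and k: "4 dvd k" "0 < k" and d: "0 < d"
    and sub_mset: "\<And>b. set_mset (turn_mset b) \<subseteq> {j * d | j. odd j \<and> j \<le> k - 1}"
    and size: "\<And>b. size (turn_mset b) = k div 4"
    and count: "\<And>b a. count (turn_mset b) a \<le> 1"
    and compl: "\<And>b a. a \<in># turn_mset b \<Longrightarrow> n - a \<notin># turn_mset b"
    and Q: "Q_mset n w = image_mset (\<lambda>j. (s + j * d) mod n) (mset_set {j. odd j \<and> j \<le> k - 1})"
  shows "length w = k" "simple" "structured d (int s)"
proof -
  have ev: "even k" using k(1) by (meson dvd_trans dvd_triv_left even_numeral)
  have fin: "finite {j. odd j \<and> j \<le> k - 1}" by (rule finite_subset[of _ "{..k - 1}"]) auto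
  have ct: "card (turns b) = k div 4" for b using size[of b] by (simp add: turn_mset_def)
  have "card straights = k div 2"
    using arg_cong[OF Q, of size] card_odd_le[OF ev] by (simp add: Q_mset_eq)
  then show len: "length w = k" using card_turns_straights ct k(1) by auto
  have "count (Q_mset n w) q \<le> 1" for q
    unfolding Q
    by (rule spec[OF iffD2[OF count_image_mset_set_le_1_iff[OF fin] inj_on_shifted_odd_multiples[OF n k(2) d]]])
  then show simple: simple unfolding simple_iff_msets using count compl by blast
  have dn: "2 * d dvd n" using ev by (auto simp: n elim!: evenE)
  then have dn': "2 * int d dvd int n" by (metis of_nat_dvd_iff of_nat_mult of_nat_numeral)
  \<comment> \<open>Both sides are invariant under multiples of \<open>n\<close>, so agreement on
    one period suffices.\<close>
  have extend: "P x \<longleftrightarrow> 2 * int d dvd x - r"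
    if P: "{x \<in> {0..<int n}. P x} = {x \<in> {0..<int n}. 2 * int d dvd x - r}"
      and cong: "\<And>x y. int n dvd x - y \<Longrightarrow> P x \<longleftrightarrow> P y" for P r x
  proof -
    have nx: "int n dvd x - x mod int n" by (simp add: mod_eq_dvd_iff[symmetric])
    have "x mod int n \<in> {0..<int n}" using n_pos by simp
    then have "P (x mod int n) \<longleftrightarrow> 2 * int d dvd x mod int n - r" using P by blast
    moreover have "2 * int d dvd x - x mod int n" using nx dn' dvd_trans by blast
    then have "2 * int d dvd x mod int n - r \<longleftrightarrow> 2 * int d dvd x - r"
      using dvd_add_right_iff[of "2 * int d" "x - x mod int n" "x mod int n - r"] by simp
    ultimately show ?thesis using cong[OF nx] by blast
  qed
  have TT: "joined b b x \<longleftrightarrow> 2 * int d dvd x - int d" for b x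
  proof (rule extend)
    let ?R = "{x \<in> {0..<int n}. 2 * int d dvd x - int d}"
    have "card ?R = k div 2"
      using card_residue_class[OF dn n_pos, of "int d"] d ev by (auto simp: n elim!: evenE)
    moreover have "card {x \<in> {0..<int n}. joined b b x} = k div 2"
      using card_joined_same[OF simple, of b] ct[of b] k(1) by auto
    moreover have "{x \<in> {0..<int n}. joined b b x} \<subseteq> ?R"
    proof
      fix x assume "x \<in> {x \<in> {0..<int n}. joined b b x}"
      then obtain p where x: "0 \<le> x" "x < int n" and p: "p \<in> turns b" "int n dvd x - diff p \<or> int n dvd x + diff p"
        by (auto simp: joined_same_iff)
      have "nat (diff p mod int n) \<in># turn_mset b" using p by (simp add: turn_mset_def)
      then obtain j where j: "nat (diff p mod int n) = j * d" "odd j" using sub_mset[of b] by blast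
      have "diff p mod int n = int j * int d" using arg_cong[OF j(1), of int] n_pos by simp
      moreover have "int n dvd diff p - diff p mod int n" by (simp add: mod_eq_dvd_iff[symmetric])
      ultimately have "int n dvd diff p - int j * int d" by (simp only:)
      then have "2 * int d dvd diff p - int j * int d" using dn' dvd_trans by blast
      moreover have "2 * int d dvd int j * int d - int d"
        using j(2) by (auto elim!: oddE simp: algebra_simps)
      ultimately have "2 * int d dvd (diff p - int j * int d) + (int j * int d - int d)"
        by (rule dvd_add)
      then have dp: "2 * int d dvd diff p - int d" by simp
      from p(2) have "2 * int d dvd x - int d"
      proof
        assume "int n dvd x - diff p"
        then have "2 * int d dvd x - diff p" using dn' dvd_trans by blast
        from dvd_add[OF this dp] show ?thesis by simp
      next
        assume "int n dvd x + diff p"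
        then have "2 * int d dvd x + diff p" using dn' dvd_trans by blast
        from dvd_diff[OF this dp] have "2 * int d dvd x + int d" by simp
        from dvd_diff[OF this, of "2 * int d"] show ?thesis by simp
      qed
      with x show "x \<in> ?R" by simp
    qed
    ultimately show "{x \<in> {0..<int n}. joined b b x} = ?R"
      by (intro card_subset_eq finite_subset[of ?R "{0..<int n}"]) auto
  qed (rule joined_cong)
  have TF: "joined True False x \<longleftrightarrow> 2 * int d dvd x - (int s + int d)" for x
  proof (rule extend)
    have "nat ` {x \<in> {0..<int n}. joined True False x} = set_mset (Q_mset n w)"
      unfolding joined_True_False_image by (simp add: Q_mset_eq image_image)
    also have "\<dots> = nat ` {x \<in> {0..<int n}. 2 * int d dvd x - int s - int d}"
      unfolding residue_class_eq_image[OF n ev k(2) d] Q using fin by simp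
    finally have "int ` nat ` {x \<in> {0..<int n}. joined True False x} =
        int ` nat ` {x \<in> {0..<int n}. 2 * int d dvd x - int s - int d}" by (rule arg_cong)
    moreover have "int ` nat ` {x \<in> {0..<int n}. P x} = {x \<in> {0..<int n}. P x}" for P
      by (force simp: image_image)
    ultimately show "{x \<in> {0..<int n}. joined True False x} =
        {x \<in> {0..<int n}. 2 * int d dvd x - (int s + int d)}" by (simp add: algebra_simps)
  qed (rule joined_cong)
  show "structured d (int s)"
    using TT TF by (simp add: structured_def algebra_simps)
qed

text \<open>Lowering the subscripts of the negative letters by \<open>s\<close> absorbs the
  translate: for all four combinations of signs, adjacency then means that the colours differ by
  \<open>d\<close> modulo \<open>2 * d\<close>.\<close>

definition colour :: "int \<Rightarrow> nat letter \<Rightarrow> int" where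
  "colour s v = int (fst v) - (if snd v then 0 else s)"

lemma coloured_graph_G:
  assumes simple: simple and str: "structured d s" and d: "0 < d" and ne: "0 < card (turns True)"
  shows "coloured_graph G (colour s) d"
proof
  have dn: "2 * int d dvd int n"
    using structured_dvd[OF str] by (metis of_nat_dvd_iff of_nat_mult of_nat_numeral)
  have col: "2 * int d dvd colour s (vertex b i) - (i - (if b then 0 else s))" for b i
  proof -
    have "int n dvd i mod int n - i" by (simp add: mod_eq_dvd_iff[symmetric])
    moreover have "colour s (vertex b i) - (i - (if b then 0 else s)) = i mod int n - i"
      using n_pos by (simp add: colour_def vertex_def)
    ultimately show ?thesis using dn dvd_trans by metis
  qed
  show "wellformed G" by (rule wellformed_G)
  show "inj_on (ends G) (edges G)" by (rule inj_on_ends_if_simple[OF simple])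
  show "0 < d" by (rule d)
  show "adjacent G u v \<longleftrightarrow> 2 * int d dvd colour s v - colour s u - int d"
    if u: "u \<in> verts G" and v: "v \<in> verts G" for u v
  proof -
    obtain b i where ui: "u = vertex b i" using u by (rule verts_cases)
    obtain c l where vl: "v = vertex c l" using v by (rule verts_cases)
    define L where "L = l - (if c then 0 else s)"
    define I where "I = i - (if b then 0 else s)"
    have "2 * int d dvd (colour s v - L) - (colour s u - I)"
      unfolding ui vl L_def I_def by (rule dvd_diff[OF col col])
    from dvd_add_right_iff[OF this, of "L - I - int d"]
    have *: "2 * int d dvd colour s v - colour s u - int d \<longleftrightarrow> 2 * int d dvd L - I - int d"
      by (simp add: algebra_simps)
    have FT: "joined False True x \<longleftrightarrow> 2 * int d dvd x + s - int d" for x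
    proof -
      have "joined False True x \<longleftrightarrow> 2 * int d dvd - x - s - int d"
        using joined_minus[of False True "- x"] structuredD(2)[OF str, of "- x"] by simp
      also have "- x - s - int d = - (x + s - int d) - 2 * int d" by simp
      also have "2 * int d dvd - (x + s - int d) - 2 * int d \<longleftrightarrow> 2 * int d dvd - (x + s - int d)"
        by (metis diff_add_cancel dvd_add dvd_diff dvd_refl)
      also have "\<dots> \<longleftrightarrow> 2 * int d dvd x + s - int d" by (rule dvd_minus_iff)
      finally show ?thesis .
    qed
    show ?thesis
      unfolding * unfolding ui vl adjacent_vertex_iff L_def I_def
      using structuredD[OF str] FT by (cases b; cases c) (simp_all add: algebra_simps)
  qed
  show "3 \<le> card {v \<in> verts G. 2 * int d dvd colour s v - r}" for r
  proof -
    let ?S = "{v \<in> verts G. 2 * int d dvd colour s v - r}"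
    have mem: "vertex b i \<in> ?S" if "2 * int d dvd (i - (if b then 0 else s)) - r" for b i
      using dvd_add[OF col[of b i] that] vertex_in_verts by simp
    \<comment> \<open>Three vertices of colour \<open>r\<close> modulo \<open>2 * d\<close>, which
      give the degree at least 3. The two positive ones differ because \<open>n\<close> is at least
      \<open>4 * d\<close>.\<close>
    let ?T = "{vertex True r, vertex True (r + 2 * int d), vertex False (r + s)}"
    have "?T \<subseteq> ?S"
      using mem[of r True] mem[of "r + 2 * int d" True] mem[of "r + s" False]
      by (simp only: insert_subset empty_subsetI) simp
    moreover have "finite ?S" by (simp add: star_graph_def)
    ultimately have "card ?T \<le> card ?S" by (rule card_mono[rotated])
    moreover have "card ?T = 3"
    proof -
      have "n = d * length w" "length w = 4 * card (turns True)"
        using structured_counts[OF simple str d] by auto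
      then have "2 * d < n" using d ne by (cases "card (turns True)") auto
      then have "\<not> int n dvd 2 * int d"
        using d by (auto dest: zdvd_imp_le)
      then have "vertex True r \<noteq> vertex True (r + 2 * int d)"
        by (simp add: vertex_eq_iff)
      then show ?thesis by (simp add: vertex_eq_iff)
    qed
    ultimately show ?thesis by simp
  qed
  show "\<exists>f. bij_betw f (verts G) (verts G) \<and>
      (\<forall>v\<in>verts G. 2 * int d dvd colour s (f v) - colour s v - t)" for t
  proof -
    \<comment> \<open>Shifting all subscripts by \<open>t\<close> keeps the signs and raises every
      colour by \<open>t\<close> modulo \<open>2 * d\<close>.\<close>
    define f where "f t v = vertex (snd v) (int (fst v) + t)" for t and v :: "nat letter"
    have f: "f t (vertex b i) = vertex b (i + t)" for t b i
      using n_pos unfolding f_def vertex_def by (simp add: mod_add_left_eq)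
    have "f (- t) (f t v) = v" if "v \<in> verts G" for t v
      using that by (rule verts_cases) (simp add: f)
    from this this[of _ "- t"] have "bij_betw (f t) (verts G) (verts G)"
      by (intro bij_betw_byWitness[of _ "f (- t)"]) (auto simp: f_def vertex_in_verts)
    moreover have "2 * int d dvd colour s (f t v) - colour s v - t" if "v \<in> verts G" for v
    proof -
      from that obtain b i where v: "v = vertex b i" by (rule verts_cases)
      from dvd_diff[OF col[of b "i + t"] col[of b i]] show ?thesis by (simp add: v f algebra_simps)
    qed
    ultimately show ?thesis by blast
  qed
qed

section \<open>Special presentations and the normal form of adjacency\<close>

lemma special_if_structured:
  assumes "simple" "structured d s" "0 < d" "0 < card (turns True)"
  shows "special 2 (length w) d (cyclic_presentation n w)"
proof -
  interpret coloured_graph G "colour s" d by (rule coloured_graph_G[OF assms])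
  have comp: "\<exists>u\<in>verts G. C = component G u" if "C \<in> graph_components G" for C
    using that by (auto simp: graph_components_def)
  have iso: "graph_isomorphic C D" if "C \<in> graph_components G" "D \<in> graph_components G" for C D
    using comp[OF that(1)] comp[OF that(2)] isomorphic_components by blast
  have props: "connected_graph C \<and> bipartite C \<and> diameter C = enat 2 \<and> girth C = enat (2 * 2) \<and>
      (\<forall>v\<in>verts C. 3 \<le> degree C v)" if C: "C \<in> graph_components G" for C
  proof -
    obtain u where u: "u \<in> verts G" "C = component G u" using comp[OF C] by blast
    show ?thesis
      unfolding u(2)
      using connected_component[OF wf u(1)] bipartite_component[OF u(1)] diameter_component[OF u(1)]
        girth_component[OF u(1)] degree_component[OF u(1)]
      by (simp add: numeral_eq_enat del: verts_component)
  qed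
  have "4 \<le> length w" using structured_counts(2)[OF assms(1-3)] length_pos by (auto dest: dvd_imp_le)
  then show ?thesis
    unfolding special_def
    using assms(3) card_components iso props relator_in_carrier cyclically_reduced_relator
    by auto
qed

text \<open>Paths through the subscripts 0, \<open>x\<close>, \<open>x + y\<close>,
  \<open>x + y + z\<close> turn the closure of paths into closure of \<open>joined\<close> under
  sums of three. The nonempty sets of turns and straights supply one difference of each
  kind.\<close>

lemma structured_if_special:
  assumes special: "special 2 k \<nu> (cyclic_presentation n w)"
    and "non_redundant (cyclic_presentation n w)" "\<not> proper_power (free_group {..<n}) w"
    and turns: "\<And>b. turns b \<noteq> {}" and straights: "straights \<noteq> {}"
  obtains s where "simple" "structured \<nu> s" "length w = k" "0 < \<nu>"
proof -
  interpret bipartite_components G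
  proof
    show "wellformed G" by (rule wellformed_G)
    fix C assume "C \<in> graph_components G"
    then show "bipartite C \<and> diameter C = 2 \<and> girth C = 4"
      using special by (simp add: special_def numeral_eq_enat)
  qed
  have simple: simple by (rule simple_if_inj_on[OF inj_on_ends edge_inj[OF assms(2,3)]])
  have tri: "joined b c' (x + y + z)" if "joined b c x" "joined c b' y" "joined b' c' z" for b c b' c' x y z
    using adjacent_triple[of "vertex b 0" "vertex c x" "vertex b' (x + y)" "vertex c' (x + y + z)"] that
    by (simp add: adjacent_vertex_iff)
  have irr: "\<not> joined True True 0" using not_adjacent_refl[of "vertex True 0"] by (simp add: adjacent_vertex_iff)
  obtain p q r where "p \<in> turns True" "q \<in> turns False" "r \<in> straights"
    using turns straights by blast
  note ex = joined_diff[OF this(1)] joined_diff[OF this(2)] joined_odiff[OF this(3)]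
  obtain d s where ds: "0 < d" "\<And>b x. joined b b x \<longleftrightarrow> 2 * d dvd x - d"
    "\<And>x. joined True False x \<longleftrightarrow> 2 * d dvd x - s - d"
  proof -
    note obtained = that
    show thesis
    proof (rule odd_multiples_structure[of joined "diff p" "diff q" "odiff r"])
      show "joined c b (- x) \<longleftrightarrow> joined b c x" for b c x by (rule joined_minus)
      show "joined b c' (x + y + z)" if "joined b c x" "joined c b' y" "joined b' c' z" for b c b' c' x y z
        by (rule tri[OF that])
    qed (fact irr ex obtained)+
  qed
  define e where "e = nat d"
  have e: "0 < e" "d = int e" using ds(1) by (simp_all add: e_def)
  have str: "structured e s" using ds(2,3) by (simp add: structured_def e(2))
  have "0 < card (turns True)" using turns by (simp add: card_gt_0_iff)
  then interpret coloured_graph G "colour s" e by (rule coloured_graph_G[OF simple str e(1)])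
  \<comment> \<open>The colouring counts the components a second time, which identifies
    \<open>e\<close>.\<close>
  have "e = \<nu>" using special card_components by (simp add: special_def)
  \<comment> \<open>As \<open>n\<close> is positive there is a relator, so the common length
    \<open>k\<close> is that of \<open>w\<close>.\<close>
  moreover have "length w = k" using special n_pos by (force simp: special_def)
  ultimately show ?thesis using that simple str e(1) by blast
qed

text \<open>\<open>s\<close> matters only modulo \<open>2 * d\<close>, a divisor of
  \<open>n\<close>, so it can be moved into the range that the statement prescribes.\<close>

lemma structured_shift_nonneg:
  assumes "structured d s"
  shows "structured d (int (nat (s mod int n)))"
proof -
  have "2 * int d dvd int n"
    using structured_dvd[OF assms] by (metis of_nat_dvd_iff of_nat_mult of_nat_numeral)
  moreover have "int n dvd s - s mod int n" by (simp add: mod_eq_dvd_iff[symmetric])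
  ultimately have "2 * int d dvd s - s mod int n" by (rule dvd_trans)
  from dvd_add_right_iff[OF this, of "x - s - int d" for x]
  have "2 * int d dvd x - s mod int n - int d \<longleftrightarrow> 2 * int d dvd x - s - int d" for x
    by (simp add: algebra_simps)
  then show ?thesis using assms n_pos by (simp add: structured_def)
qed

end

theorem theorem5:
  fixes n \<nu> k :: nat and w :: "nat word"
  assumes "1 \<le> n" and "1 \<le> \<nu>" and "3 \<le> k"
    and "w \<in> carrier (free_group {..<n})" and "cyclically_reduced w"
    and "0 \<in> fst ` set w"
    and "\<not> positive_word w" and "\<not> negative_word w" and "\<not> alternating_word w"
    and "\<not> proper_power (free_group {..<n}) w"
    and "irreducible_cyclic n w"
    and "non_redundant (cyclic_presentation n w)"
  shows "special 2 k \<nu> (cyclic_presentation n w) \<longleftrightarrow>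
    (n = \<nu> * k \<and> 4 dvd k) \<and>
    (set_mset (A_mset n w) \<subseteq> {j * \<nu> | j. odd j \<and> j \<le> k - 1} \<and>
     set_mset (B_mset n w) \<subseteq> {j * \<nu> | j. odd j \<and> j \<le> k - 1} \<and>
     (\<forall>a. count (A_mset n w) a \<le> 1) \<and> (\<forall>b. count (B_mset n w) b \<le> 1) \<and>
     size (A_mset n w) = k div 4 \<and> size (B_mset n w) = k div 4 \<and>
     (\<forall>a. a \<in># A_mset n w \<longrightarrow> n - a \<notin># A_mset n w) \<and>
     (\<forall>b. b \<in># B_mset n w \<longrightarrow> n - b \<notin># B_mset n w)) \<and>
    (Qplus_mset n w \<inter># Qminus_mset n w = {#} \<and>
     (\<exists>s<n. gcd s \<nu> = 1 \<and>
       Q_mset n w = {# (s + j * \<nu>) mod n. j \<in># mset_set {j. odd j \<and> j \<le> k - 1} #}))"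
    (is "?special \<longleftrightarrow> ?a \<and> ?b \<and> ?c")
proof -
  \<comment> \<open>Letters of both signs occur, so the word has length at least 2 and changes sign
    in both directions.\<close>
  obtain x y where xy: "x \<in> set w" "y \<in> set w" "\<not> snd x" "snd y"
    using assms(7,8) unfolding positive_word_def negative_word_def by blast
  have "card {x, y} \<le> card (set w)" using xy by (intro card_mono) auto
  also have "card (set w) \<le> length w" by (rule card_length)
  also have "card {x, y} = 2" using xy by (auto simp: card_insert_if)
  finally have "2 \<le> length w" .
  then interpret cyclic_word n w
    by unfold_locales (use assms in \<open>auto simp: free_group_def\<close>)
  obtain i j where "i < length w" "j < length w" "w ! i = x" "w ! j = y"
    using xy by (auto simp: in_set_conv_nth)
  then have "\<not> sgn i" "sgn j" using xy by (simp_all add: sgn_def)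
  then have turns: "turns b \<noteq> {}" for b
    using turns_nonempty[of i b j] turns_nonempty[of j b i] by (cases b) auto
  show ?thesis
    unfolding turn_mset_eq
  proof
    assume ?special
    then obtain s' where simple: simple and str': "structured \<nu> s'" and len: "length w = k" and pos: "0 < \<nu>"
      using structured_if_special[OF _ assms(12,10) turns straights_nonempty[OF assms(9)]] by blast
    define s where "s = nat (s' mod int n)"
    have str: "structured \<nu> (int s)" unfolding s_def by (rule structured_shift_nonneg[OF str'])
    have "s < n" using n_pos by (simp add: s_def nat_less_iff)
    note counts = structured_counts[OF simple str pos, unfolded len]
    have A1: "set_mset (turn_mset b) \<subseteq> {j * \<nu> | j. odd j \<and> j \<le> k - 1}" for b
      using turn_value[OF simple str pos, of _ b] len by (auto simp: turn_mset_def)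
    have A2: "size (turn_mset b) = k div 4" for b
      using counts(3) by (simp add: turn_mset_def)
    have A3: "\<forall>a. count (turn_mset b) a \<le> 1" "\<forall>a. a \<in># turn_mset b \<longrightarrow> n - a \<notin># turn_mset b" for b
      using simple unfolding simple_iff_msets by blast+
    have A4: "gcd s \<nu> = 1" by (rule gcd_shift[OF simple str pos assms(11,6)])
    note A5 = Q_mset_structured[OF simple str pos, unfolded len]
    show "(n = \<nu> * k \<and> 4 dvd k) \<and>
      (set_mset (turn_mset True) \<subseteq> {j * \<nu> | j. odd j \<and> j \<le> k - 1} \<and>
       set_mset (turn_mset False) \<subseteq> {j * \<nu> | j. odd j \<and> j \<le> k - 1} \<and>
       (\<forall>a. count (turn_mset True) a \<le> 1) \<and> (\<forall>b. count (turn_mset False) b \<le> 1) \<and>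
       size (turn_mset True) = k div 4 \<and> size (turn_mset False) = k div 4 \<and>
       (\<forall>a. a \<in># turn_mset True \<longrightarrow> n - a \<notin># turn_mset True) \<and>
       (\<forall>b. b \<in># turn_mset False \<longrightarrow> n - b \<notin># turn_mset False)) \<and> ?c"
      by (intro conjI exI[of _ s])
        (fact counts(1,2) A1 A2 A3 A4 A5 Qplus_Qminus_disjoint[OF simple] \<open>s < n\<close>)+
  next
    assume R: "(n = \<nu> * k \<and> 4 dvd k) \<and>
      (set_mset (turn_mset True) \<subseteq> {j * \<nu> | j. odd j \<and> j \<le> k - 1} \<and>
       set_mset (turn_mset False) \<subseteq> {j * \<nu> | j. odd j \<and> j \<le> k - 1} \<and>
       (\<forall>a. count (turn_mset True) a \<le> 1) \<and> (\<forall>b. count (turn_mset False) b \<le> 1) \<and>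
       size (turn_mset True) = k div 4 \<and> size (turn_mset False) = k div 4 \<and>
       (\<forall>a. a \<in># turn_mset True \<longrightarrow> n - a \<notin># turn_mset True) \<and>
       (\<forall>b. b \<in># turn_mset False \<longrightarrow> n - b \<notin># turn_mset False)) \<and> ?c"
    then obtain s where Q: "Q_mset n w = {# (s + j * \<nu>) mod n. j \<in># mset_set {j. odd j \<and> j \<le> k - 1} #}"
      by blast
    have R': "set_mset (turn_mset b) \<subseteq> {j * \<nu> | j. odd j \<and> j \<le> k - 1}" "size (turn_mset b) = k div 4"
      "count (turn_mset b) a \<le> 1" "a \<in># turn_mset b \<Longrightarrow> n - a \<notin># turn_mset b" for a b
      using R by (cases b; simp)+
    have pos: "0 < \<nu>" "0 < k" using assms(2,3) by simp_all
    have nk: "n = \<nu> * k" "4 dvd k" using R by simp_all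
    have str: "length w = k" simple "structured \<nu> (int s)"
      using structured_if_conditions[OF nk pos(2,1) R' Q] by blast+
    have "0 < card (turns True)" using turns by (simp add: card_gt_0_iff)
    from special_if_structured[OF str(2,3) pos(1) this] show ?special by (simp add: str(1))
  qed
qed

end
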